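(* Let $N=2k+1$ be an odd positive integer and let $C_N=\{\alpha_0,\dots,\alpha_{N-1}\}$ be the $N$-cycle with metric $d(\alpha_i,\alpha_j)=2\min\{|j-i|,\,N-|j-i|\}$. The injective hull $\operatorname{E}(C_N)$ has the following realization. The vertices of $\operatorname{E}(C_N)$ are parametrized by the partitions in $\mathbb Y_N^\circ$: to $\lambda\in\mathbb Y_N^\circ$, with outer rim $\mathcal L_\lambda=\{(i_l,j_l)\mid l=0,\dots,N-1\}\subseteq\mathfrak X_N^\circ$ (a set of $N$ sites), corresponds the vertex $g_\lambda\in\mathbb R^{C_N}$ which is the (unique) solution $g$ of the linear system $$g(\alpha_{i_l})+g(\alpha_{j_l})=d(\alpha_{i_l},\alpha_{j_l})\qquad(l=0,\dots,N-1),$$ explicitly $$g_\lambda(\alpha_j)=\bigl|\tau^j(\lambda)\bigr|-\tfrac12k(k-1)\qquad(j=0,\dots,N-1);$$ that is, $\lambda\mapsto g_\lambda$ is a bijection from $\mathbb Y_N^\circ$ onto the set of vertices of $\operatorname{E}(C_N)$. For each $v\geqslant 0$, the $v$-dimensional faces of $\operatorname{E}(C_N)$ are exactly the convex hulls of the $2^v$ vertices $g_\nu$, $\nu\in[\lambda',\lambda]$, where $\lambda,\lambda'\in\mathbb Y_N^\circ$ and $\lambda'$ is obtained by removing $v$ inner corners from $\lambda$.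
   Context: Injective hull. For a finite metric space $(X,d)$ put $\Delta(X)=\{g\in\mathbb R^{X}\mid g(x)+g(y)\geqslant d(x,y)\ \forall x,y\in X\}$ (including $x=y$) and $\operatorname{E}(X)=\{g\in\Delta(X)\mid \forall x\in X\ \exists y\in X:\ g(x)+g(y)=d(x,y)\}$. This is a polyhedral complex: its faces are the (compact) faces of the polyhedron $\Delta(X)$ that are contained in $\operatorname{E}(X)$; a $v$-face is a face of dimension $v$, and vertices are $0$-faces. Partitions. A partition $\lambda=(\lambda_1,\dots,\lambda_m)$ is a weakly decreasing finite sequence of positive integers (possibly empty, $m=0$); $|\lambda|=\sum_l\lambda_l$; set $\lambda_l=0$ for $l>m$. Partitions are ordered by inclusion of Young diagrams (Young's lattice), and $[\lambda',\lambda]$ denotes an interval in this order. An inner corner of $\lambda$ is a box of its Young diagram whose removal leaves the Young diagram of a partition; "removing $v$ inner corners from $\lambda$" means removing $v$ distinct inner corners of $\lambda$ simultaneously. $\mathbb Y_N$ is the set of partitions with maximal hook length $<N$, i.e. the empty partition together with all nonempty $\lambda$ satisfying $\lambda_1+m-1<N$. Cyclic action. $\tau:\mathbb Y_N\to\mathbb Y_N$ is given by $\tau(\lambda)=(N-m-1,\lambda_1-1,\dots,\lambda_m-1)$ with trailing zeros removed; for the empty partition this means $\tau(())=(N-1)$ (with a zero removed if $N=1$). It satisfies $\tau^N=\mathrm{id}$. Möbius strip and outer rims. The discrete Möbius strip $\mathfrak X_N$ is the set of sites obtained from the positions $(i,j)$, $0\leqslant i\leqslant j\leqslant N$, by identifying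 $(i,N)$ with $(0,i)$ for $i=0,\dots,N$; it has $\frac12N(N+1)$ sites. For $\lambda=(\lambda_1,\dots,\lambda_m)\in\mathbb Y_N$ the outer rim $\mathcal L_\lambda\subseteq\mathfrak X_N$ is the set of sites represented by the positions $$\{(i,j)\mid \lambda_1\leqslant j\leqslant N,\ \lambda_{N+1-j}\leqslant i\leqslant\lambda_{N-j}\},\qquad\text{with the convention }\lambda_0:=N-m .$$ It consists of exactly $N$ sites. (Pictorially: place the box in row $r$, column $c$ of the Young diagram at position $(c-1,N+1-r)$; then $\mathcal L_\lambda$ is the closed loop of sites in the Möbius strip running along the outside of the Young diagram. E.g. for $N=9$, $\lambda=(5,5,2,1)$ it is $(0,5),(1,5),(1,6),(2,6),(2,7),(3,7),(4,7),(5,7),(5,8),(5,9)=(0,5)$.) Put $\alpha_N:=\alpha_0$, so that expressions $g(\alpha_i)+g(\alpha_j)$ and $d(\alpha_i,\alpha_j)$ make sense for a site $(i,j)$ and do not depend on the representing position. For $N=2k+1$: $\mathfrak X_N^\circ=\{(i,j)\in\mathfrak X_N\mid d(\alpha_i,\alpha_j)\geqslant 2(k-1)\}$, i.e. the sites with $k-1\leqslant j-i\leqslant k+2$, and $\mathbb Y_N^\circ=\{\lambda\in\mathbb Y_N\mid\mathcal L_\lambda\subseteq\mathfrak X_N^\circ\}$. The action $\tau$ restricts to $\mathbb Y_N^\circ$. *)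

theory Defs
  imports "HOL-Analysis.Analysis"
begin

section \<open>Injective hull of a finite metric space\<close>

text \<open>A metric on a finite set is a function \<open>d\<close> on a finite type \<open>'a\<close>;
  \<open>\<real>\<^sup>X\<close> is \<^typ>\<open>real ^ 'a\<close>.\<close>

definition hull_polyhedron :: "('a::finite \<Rightarrow> 'a \<Rightarrow> real) \<Rightarrow> (real ^ 'a) set" where
  "hull_polyhedron d = {g. \<forall>x y. g $ x + g $ y \<ge> d x y}"

definition injective_hull :: "('a::finite \<Rightarrow> 'a \<Rightarrow> real) \<Rightarrow> (real ^ 'a) set" where
  "injective_hull d = {g \<in> hull_polyhedron d. \<forall>x. \<exists>y. g $ x + g $ y = d x y}"

text \<open>Faces contained in the injective hull are automatically compact, see
  \<open>compact_hull_face\<close> below. As \<open>aff_dim {} = - 1\<close>, a \<open>v\<close>-face is nonempty.\<close>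

definition hull_face :: "('a::finite \<Rightarrow> 'a \<Rightarrow> real) \<Rightarrow> nat \<Rightarrow> (real ^ 'a) set \<Rightarrow> bool" where
  "hull_face d v F \<longleftrightarrow>
     F face_of hull_polyhedron d \<and> F \<subseteq> injective_hull d \<and> aff_dim F = int v"

definition hull_vertices :: "('a::finite \<Rightarrow> 'a \<Rightarrow> real) \<Rightarrow> (real ^ 'a) set" where
  "hull_vertices d = {g. hull_face d 0 {g}}"

lemma polyhedron_hull_polyhedron: "polyhedron (hull_polyhedron d)"
proof -
  have "hull_polyhedron d =
      (\<Inter>p. {g. (axis (fst p) 1 + axis (snd p) 1) \<bullet> g \<ge> d (fst p) (snd p)})"
    by (auto simp: hull_polyhedron_def inner_add_left inner_axis')
  also have "polyhedron \<dots>"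
    by (rule polyhedron_Inter) (auto intro: polyhedron_halfspace_ge)
  finally show ?thesis .
qed

lemma compact_hull_face:
  assumes "F face_of hull_polyhedron d" "F \<subseteq> injective_hull d"
  shows "compact F"
proof -
  let ?M = "Max (range (\<lambda>p. \<bar>d (fst p) (snd p)\<bar>))"
  have M: "\<bar>d x y\<bar> \<le> ?M" for x y
    by (rule Max_ge) (auto intro: image_eqI[of _ _ "(x, y)"])
  have "\<bar>g $ x\<bar> \<le> 2 * ?M" if g: "g \<in> injective_hull d" for g x
  proof -
    have ge: "2 * (g $ z) \<ge> d z z" for z
      using g by (force simp: injective_hull_def hull_polyhedron_def dest: spec[of _ z])
    obtain y where "g $ x + g $ y = d x y"
      using g by (auto simp: injective_hull_def)
    then show ?thesis
      using ge[of x] ge[of y] M[of x x] M[of y y] M[of x y] by linarith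
  qed
  then have "F \<subseteq> {g. \<forall>x. g $ x \<in> {- 2 * ?M .. 2 * ?M}}"
    using assms(2) by (force simp: abs_le_iff minus_le_iff)
  also have "\<dots> = cbox (\<chi> x. - 2 * ?M) (\<chi> x. 2 * ?M)"
    by (auto simp: mem_box_cart)
  finally have "bounded F"
    using bounded_cbox bounded_subset by blast
  moreover have "closed F"
    using assms(1) polyhedron_hull_polyhedron[of d]
    by (meson face_of_imp_closed polyhedron_imp_closed polyhedron_imp_convex)
  ultimately show ?thesis
    by (simp add: compact_eq_bounded_closed)
qed


section \<open>Partitions\<close>

definition is_partition :: "nat list \<Rightarrow> bool" where
  "is_partition \<mu> \<longleftrightarrow> sorted_wrt (\<ge>) \<mu> \<and> 0 \<notin> set \<mu>"

text \<open>The part \<open>\<mu>\<^sub>l\<close>, numbered from \<open>l = 1\<close>; it is \<open>0\<close> beyond the length of \<open>\<mu>\<close>.\<close>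

definition row_len :: "nat list \<Rightarrow> nat \<Rightarrow> nat" where
  "row_len \<mu> l = (if 1 \<le> l \<and> l \<le> length \<mu> then \<mu> ! (l - 1) else 0)"

definition young_diagram :: "nat list \<Rightarrow> (nat \<times> nat) set" where
  "young_diagram \<mu> = {(r, c). 1 \<le> r \<and> r \<le> length \<mu> \<and> 1 \<le> c \<and> c \<le> row_len \<mu> r}"

definition young_interval :: "nat list \<Rightarrow> nat list \<Rightarrow> nat list set" where
  "young_interval \<rho> \<mu> = {\<nu>. is_partition \<nu> \<and>
     young_diagram \<rho> \<subseteq> young_diagram \<nu> \<and> young_diagram \<nu> \<subseteq> young_diagram \<mu>}"

definition inner_corners :: "nat list \<Rightarrow> (nat \<times> nat) set" where
  "inner_corners \<mu> = {b \<in> young_diagram \<mu>.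
     \<exists>\<rho>. is_partition \<rho> \<and> young_diagram \<rho> = young_diagram \<mu> - {b}}"

definition removes_corners :: "nat \<Rightarrow> nat list \<Rightarrow> nat list \<Rightarrow> bool" where
  "removes_corners v \<mu> \<rho> \<longleftrightarrow>
     (\<exists>B. B \<subseteq> inner_corners \<mu> \<and> card B = v \<and> young_diagram \<rho> = young_diagram \<mu> - B)"

text \<open>The hook of a box, so that its hook length is \<open>card (hook \<mu> b)\<close>. The maximal hook
  length of a nonempty partition is that of the box \<open>(1, 1)\<close>; the explicit form of the bound is
  \<open>bounded_hook_partitions_iff\<close> below.\<close>

definition hook :: "nat list \<Rightarrow> nat \<times> nat \<Rightarrow> (nat \<times> nat) set" where
  "hook \<mu> b = {(r, c) \<in> young_diagram \<mu>.
     (r = fst b \<and> c \<ge> snd b) \<or> (c = snd b \<and> r \<ge> fst b)}"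

definition bounded_hook_partitions :: "nat \<Rightarrow> nat list set" where
  "bounded_hook_partitions N =
     {\<mu>. is_partition \<mu> \<and> (\<forall>b \<in> young_diagram \<mu>. card (hook \<mu> b) < N)}"

lemma row_len_antimono:
  assumes "is_partition \<mu>" "1 \<le> r" "r \<le> s"
  shows "row_len \<mu> s \<le> row_len \<mu> r"
proof (cases "r = s \<or> s > length \<mu>")
  case True
  then show ?thesis by (auto simp: row_len_def)
next
  case False
  then have "\<mu> ! (s - 1) \<le> \<mu> ! (r - 1)"
    using assms sorted_wrt_nth_less[of "(\<ge>)" \<mu> "r - 1" "s - 1"] by (auto simp: is_partition_def)
  then show ?thesis using False assms by (auto simp: row_len_def)
qed

lemma hook_corner:
  assumes "is_partition \<mu>" "\<mu> \<noteq> []"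
  shows "card (hook \<mu> (1, 1)) = row_len \<mu> 1 + length \<mu> - 1"
proof -
  have pos: "row_len \<mu> r \<ge> 1" if "1 \<le> r" "r \<le> length \<mu>" for r
  proof -
    have "\<mu> ! (r - 1) \<in> set \<mu>" using that by (intro nth_mem) auto
    then have "\<mu> ! (r - 1) \<noteq> 0" using assms(1) by (metis is_partition_def)
    then show ?thesis using that by (simp add: row_len_def)
  qed
  have "hook \<mu> (1, 1) = {1} \<times> {1..row_len \<mu> 1} \<union> {2..length \<mu>} \<times> {1}"
    using assms(2) pos
    by (fastforce simp: hook_def young_diagram_def Suc_le_eq)
  moreover have "card ({1} \<times> {1..row_len \<mu> 1} \<union> {2..length \<mu>} \<times> {1}) =
      card ({1::nat} \<times> {1..row_len \<mu> 1}) + card ({2..length \<mu>} \<times> {1::nat})"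
    by (rule card_Un_disjoint) auto
  ultimately show ?thesis
    using pos[of 1] assms(2) by (cases \<mu>) (auto simp: card_cartesian_product)
qed

lemma bounded_hook_partitions_iff:
  "\<mu> \<in> bounded_hook_partitions N \<longleftrightarrow>
     is_partition \<mu> \<and> (\<mu> = [] \<or> row_len \<mu> 1 + length \<mu> - 1 < N)"
proof (cases "is_partition \<mu> \<and> \<mu> \<noteq> []")
  case False
  then show ?thesis by (auto simp: bounded_hook_partitions_def young_diagram_def)
next
  case True
  then have p: "is_partition \<mu>" and ne: "\<mu> \<noteq> []" by auto
  have "(1, 1) \<in> young_diagram \<mu>"
    using True by (cases \<mu>) (auto simp: young_diagram_def row_len_def is_partition_def Suc_le_eq)
  moreover have "card (hook \<mu> (r, c)) \<le> row_len \<mu> 1 + length \<mu> - 1"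
    if rc: "(r, c) \<in> young_diagram \<mu>" for r c
  proof -
    from rc have r: "1 \<le> r" "r \<le> length \<mu>" and c: "1 \<le> c" "c \<le> row_len \<mu> r"
      by (auto simp: young_diagram_def)
    have "hook \<mu> (r, c) \<subseteq> {r} \<times> {c..row_len \<mu> r} \<union> {r+1..length \<mu>} \<times> {c}"
      using c(2) by (auto simp: hook_def young_diagram_def not_less_eq_eq dest: le_antisym)
    then have "card (hook \<mu> (r, c)) \<le> card ({r} \<times> {c..row_len \<mu> r} \<union> {r+1..length \<mu>} \<times> {c})"
      by (intro card_mono) auto
    also have "\<dots> \<le> card ({r} \<times> {c..row_len \<mu> r}) + card ({r+1..length \<mu>} \<times> {c})"
      by (rule card_Un_le)
    also have "\<dots> = (Suc (row_len \<mu> r) - c) + (length \<mu> - r)"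
      by (simp add: card_cartesian_product)
    also have "\<dots> \<le> row_len \<mu> 1 + length \<mu> - 1"
      using r c row_len_antimono[OF p, of 1 r] by linarith
    finally show ?thesis .
  qed
  ultimately show ?thesis
    using p ne hook_corner[OF p ne]
    by (auto simp: bounded_hook_partitions_def intro: le_less_trans dest: bspec[of _ _ "(1, 1)"])
qed

text \<open>For \<open>N \<ge> 1\<close> and \<open>\<mu>\<close> with maximal hook length \<open>< N\<close> the new sequence is weakly decreasing, so its
  zeros are exactly its trailing zeros; the natural-number subtractions do not truncate.\<close>

definition cyclic_shift :: "nat \<Rightarrow> nat list \<Rightarrow> nat list" where
  "cyclic_shift N \<mu> = filter (\<lambda>x. x > 0) ((N - length \<mu> - 1) # map (\<lambda>x. x - 1) \<mu>)"


section \<open>The discrete Moebius strip and outer rims\<close>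

definition moebius_glue :: "nat \<Rightarrow> nat \<times> nat \<Rightarrow> nat \<times> nat \<Rightarrow> bool" where
  "moebius_glue N p q \<longleftrightarrow> (\<exists>i \<le> N. p = (i, N) \<and> q = (0, i))"

text \<open>Sites are the equivalence classes of positions. Note the class
  \<open>{(0, 0), (0, N), (N, N)}\<close>.\<close>

definition site :: "nat \<Rightarrow> nat \<times> nat \<Rightarrow> (nat \<times> nat) set" where
  "site N p = {q. equivclp (moebius_glue N) p q}"

definition moebius_strip :: "nat \<Rightarrow> (nat \<times> nat) set set" where
  "moebius_strip N = site N ` {(i, j). i \<le> j \<and> j \<le> N}"

text \<open>With the convention \<open>\<mu>\<^sub>0 = N - m\<close> for a partition of length \<open>m\<close>.\<close>

definition row_len_ext :: "nat \<Rightarrow> nat list \<Rightarrow> nat \<Rightarrow> nat" where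
  "row_len_ext N \<mu> l = (if l = 0 then N - length \<mu> else row_len \<mu> l)"

definition outer_rim :: "nat \<Rightarrow> nat list \<Rightarrow> (nat \<times> nat) set set" where
  "outer_rim N \<mu> = site N ` {(i, j). row_len \<mu> 1 \<le> j \<and> j \<le> N \<and>
     row_len_ext N \<mu> (N + 1 - j) \<le> i \<and> i \<le> row_len_ext N \<mu> (N - j)}"

text \<open>An expression symmetric in \<open>\<alpha> i\<close> and \<open>\<alpha> j\<close> depends only on the site of \<open>(i, j)\<close>, so that
  quantifying over all positions representing a site amounts to choosing one of them.\<close>

lemma site_well_defined:
  assumes "\<alpha> N = \<alpha> 0" "\<And>x y. f x y = f y x" "(i, j) \<in> site N (i', j')"
  shows "f (\<alpha> i) (\<alpha> j) = f (\<alpha> i') (\<alpha> j')"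
proof -
  let ?h = "\<lambda>p. f (\<alpha> (fst p)) (\<alpha> (snd p))"
  have glue: "?h p = ?h q" if "moebius_glue N p q" for p q
    using that assms(1,2) by (auto simp: moebius_glue_def)
  have "?h p = ?h q" if "equivclp (moebius_glue N) p q" for p q
    using that by (induction rule: equivclp_induct) (auto dest: glue)
  from this[of "(i', j')" "(i, j)"] show ?thesis
    using assms(3) by (simp add: site_def)
qed


section \<open>The odd cycle\<close>

text \<open>In the following, \<open>\<alpha> 0, \<dots>, \<alpha> (2 * k)\<close> are the points of the cycle and
  \<open>\<alpha> (2 * k + 1) = \<alpha> 0\<close>.\<close>

definition odd_cycle :: "nat \<Rightarrow> (nat \<Rightarrow> 'a) \<Rightarrow> ('a \<Rightarrow> 'a \<Rightarrow> real) \<Rightarrow> bool" where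
  "odd_cycle k \<alpha> d \<longleftrightarrow>
     (let N = 2 * k + 1 in
       bij_betw \<alpha> {..<N} UNIV \<and> \<alpha> N = \<alpha> 0 \<and>
       (\<forall>i<N. \<forall>j<N. d (\<alpha> i) (\<alpha> j) =
          2 * min \<bar>real j - real i\<bar> (real N - \<bar>real j - real i\<bar>)))"

definition inner_strip :: "nat \<Rightarrow> (nat \<Rightarrow> 'a) \<Rightarrow> ('a \<Rightarrow> 'a \<Rightarrow> real) \<Rightarrow> (nat \<times> nat) set set" where
  "inner_strip k \<alpha> d =
     {s \<in> moebius_strip (2 * k + 1). \<forall>(i, j) \<in> s. d (\<alpha> i) (\<alpha> j) \<ge> 2 * (real k - 1)}"

definition inner_partitions :: "nat \<Rightarrow> (nat \<Rightarrow> 'a) \<Rightarrow> ('a \<Rightarrow> 'a \<Rightarrow> real) \<Rightarrow> nat list set" where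
  "inner_partitions k \<alpha> d =
     {\<mu> \<in> bounded_hook_partitions (2 * k + 1). outer_rim (2 * k + 1) \<mu> \<subseteq> inner_strip k \<alpha> d}"

definition rim_solution ::
  "nat \<Rightarrow> (nat \<Rightarrow> 'a::finite) \<Rightarrow> ('a \<Rightarrow> 'a \<Rightarrow> real) \<Rightarrow> nat list \<Rightarrow> real ^ 'a \<Rightarrow> bool" where
  "rim_solution k \<alpha> d \<mu> g \<longleftrightarrow>
     (\<forall>s \<in> outer_rim (2 * k + 1) \<mu>. \<forall>(i, j) \<in> s. g $ \<alpha> i + g $ \<alpha> j = d (\<alpha> i) (\<alpha> j))"

definition rim_vertex ::
  "nat \<Rightarrow> (nat \<Rightarrow> 'a::finite) \<Rightarrow> ('a \<Rightarrow> 'a \<Rightarrow> real) \<Rightarrow> nat list \<Rightarrow> real ^ 'a" where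
  "rim_vertex k \<alpha> d \<mu> = (THE g. rim_solution k \<alpha> d \<mu> g)"

end

theory Submission
  imports Defs
begin

text \<open>Order the cycle as \<open>\<beta> 0, \<dots>, \<beta> (N - 1)\<close> so that consecutive points are at the maximal
  distance \<open>2 * k\<close>, and use the \<open>N\<close> edge sums \<open>g (\<beta> s) + g (\<beta> (s + 1))\<close> as coordinates; this is a
  linear bijection since \<open>N\<close> is odd. A point of the injective hull changes by at most \<open>2\<close> from
  \<open>\<beta> s\<close> to \<open>\<beta> (s + 2)\<close>, hence any tight pair at \<open>\<beta> s\<close> forces one of the two edges at \<open>\<beta> s\<close> to
  have edge sum \<open>2 * k\<close>. It follows that the injective hull consists of the \<open>g\<close> all of whose edge
  sums lie in \<open>[2 * k, 2 * k + 2]\<close> and exceed \<open>2 * k\<close> only on pairwise non-adjacent edges. Its faces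
  are the cubes whose vertices have edge sum \<open>2 * k + 2\<close> on \<open>T\<close> and \<open>2 * k\<close> elsewhere, for
  \<open>S' \<subseteq> T \<subseteq> S\<close>, where \<open>S\<close> is an independent set of edges.

  The rim of a partition stays in the inner strip iff its diagram lies between the staircases
  \<open>r + c \<le> k\<close> and \<open>r + c \<le> k + 2\<close> without containing both \<open>(1, k + 1)\<close> and \<open>(k + 1, 1)\<close>. The
  \<open>N\<close> free boxes, one on each diagonal, correspond to the edges. The rim site on a diagonal has
  distance \<open>2 * (k - 1)\<close> iff the free box is present, when it has \<open>r + c = k + 2\<close>, or absent, when
  it has \<open>r + c = k + 1\<close>. This identifies such partitions with independent sets, the cyclic action
  with a rotation, and removals of inner corners with cubes: of the edges in \<open>S - S'\<close>, the
  largest partition of a cube takes those of the first kind, and the smallest one those of the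
  second kind.\<close>

section \<open>Partitions and Young diagrams\<close>

lemma in_young_diagram:
  "(r, c) \<in> young_diagram \<mu> \<longleftrightarrow> 1 \<le> r \<and> 1 \<le> c \<and> c \<le> row_len \<mu> r"
  by (auto simp: young_diagram_def row_len_def)

lemma row_len_pos_iff:
  assumes "is_partition \<mu>"
  shows "1 \<le> row_len \<mu> r \<longleftrightarrow> 1 \<le> r \<and> r \<le> length \<mu>"
proof -
  have "\<mu> ! (r - 1) \<noteq> 0" if "1 \<le> r" "r \<le> length \<mu>"
  proof -
    have "\<mu> ! (r - 1) \<in> set \<mu>" using that by simp
    then show ?thesis using assms unfolding is_partition_def by metis
  qed
  then show ?thesis
    by (cases "1 \<le> r \<and> r \<le> length \<mu>") (simp_all add: row_len_def Suc_le_eq)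
qed

lemma young_diagram_downward:
  assumes "is_partition \<mu>" "(r, c) \<in> young_diagram \<mu>" "1 \<le> r'" "r' \<le> r" "1 \<le> c'" "c' \<le> c"
  shows "(r', c') \<in> young_diagram \<mu>"
  using assms row_len_antimono[OF assms(1), of r' r] by (auto simp: in_young_diagram)

lemma young_diagram_inj:
  assumes "is_partition \<mu>" "is_partition \<nu>" "young_diagram \<mu> = young_diagram \<nu>"
  shows "\<mu> = \<nu>"
proof -
  have eq: "row_len \<mu> r = row_len \<nu> r" if "1 \<le> r" for r
  proof -
    have "1 \<le> c \<and> c \<le> row_len \<mu> r \<longleftrightarrow> 1 \<le> c \<and> c \<le> row_len \<nu> r" for c
      using assms(3) that in_young_diagram[of r c \<mu>] in_young_diagram[of r c \<nu>] by simp
    from this[of "row_len \<mu> r"] this[of "row_len \<nu> r"] show ?thesis by linarith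
  qed
  have "1 \<le> r \<and> r \<le> length \<mu> \<longleftrightarrow> 1 \<le> r \<and> r \<le> length \<nu>" for r
    using row_len_pos_iff[OF assms(1), of r] row_len_pos_iff[OF assms(2), of r] eq[of r] by auto
  from this[of "length \<mu>"] this[of "length \<nu>"] have len: "length \<mu> = length \<nu>" by linarith
  show ?thesis
  proof (rule nth_equalityI[OF len])
    fix i assume "i < length \<mu>"
    then show "\<mu> ! i = \<nu> ! i" using eq[of "Suc i"] len by (simp add: row_len_def)
  qed
qed

text \<open>A finite set of boxes closed under moving up and left is recovered from its row
  cardinalities; the number of parts is the cardinality of its first column.\<close>

lemma partition_of_young_diagram:
  assumes fin: "finite Y" and pos: "\<And>r c. (r, c) \<in> Y \<Longrightarrow> 1 \<le> r \<and> 1 \<le> c"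
    and down: "\<And>r c r' c'. (r, c) \<in> Y \<Longrightarrow> 1 \<le> r' \<Longrightarrow> r' \<le> r \<Longrightarrow> 1 \<le> c' \<Longrightarrow> c' \<le> c \<Longrightarrow> (r', c') \<in> Y"
  shows "\<exists>\<mu>. is_partition \<mu> \<and> young_diagram \<mu> = Y"
proof -
  define f where "f r = card {c. (r, c) \<in> Y}" for r
  define m where "m = card {r. (r, 1) \<in> Y}"
  define \<mu> where "\<mu> = map f [1..<m+1]"
  \<comment> \<open>A finite down-closed set of positive integers is an initial segment, hence
    determined by its cardinality. This applies to every row and to the first column.\<close>
  have downset: "A = {1..card A}" if "finite A" and "\<And>x y. x \<in> A \<Longrightarrow> 1 \<le> y \<Longrightarrow> y \<le> x \<Longrightarrow> y \<in> A"
    and "\<And>x. x \<in> A \<Longrightarrow> 1 \<le> x" for A :: "nat set"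
  proof (cases "A = {}")
    case False
    have "x \<in> A \<longleftrightarrow> x \<in> {1..Max A}" for x
      using that(2)[OF Max_in[OF that(1) False], of x] that(3)[of x] Max_ge[OF that(1), of x]
      by auto
    then have "A = {1..Max A}" by blast
    then show ?thesis by (metis card_atLeastAtMost diff_Suc_1)
  qed simp
  have finr: "finite {c. (r, c) \<in> Y}" for r
    by (rule finite_subset[of _ "snd ` Y"]) (use fin in \<open>auto intro: rev_image_eqI\<close>)
  have finc: "finite {r. (r, c) \<in> Y}" for c
    by (rule finite_subset[of _ "fst ` Y"]) (use fin in \<open>auto intro: rev_image_eqI\<close>)
  have row: "(r, c) \<in> Y \<longleftrightarrow> 1 \<le> c \<and> c \<le> f r" for r c
  proof -
    have "{c. (r, c) \<in> Y} = {1..f r}"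
      unfolding f_def
    proof (rule downset[OF finr])
      show "y \<in> {c. (r, c) \<in> Y}" if "x \<in> {c. (r, c) \<in> Y}" "1 \<le> y" "y \<le> x" for x y
        using that pos[of r x] down[of r x r y] by simp
      show "1 \<le> x" if "x \<in> {c. (r, c) \<in> Y}" for x
        using that pos[of r x] by simp
    qed
    then show ?thesis by auto
  qed
  have col: "(r, 1) \<in> Y \<longleftrightarrow> 1 \<le> r \<and> r \<le> m" for r
  proof -
    have "{r. (r, 1) \<in> Y} = {1..m}"
      unfolding m_def
    proof (rule downset[OF finc])
      show "y \<in> {r. (r, 1) \<in> Y}" if "x \<in> {r. (r, 1) \<in> Y}" "1 \<le> y" "y \<le> x" for x y
        using that down[of x 1 y 1] by simp
      show "1 \<le> x" if "x \<in> {r. (r, 1) \<in> Y}" for x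
        using that pos[of x 1] by simp
    qed
    then show ?thesis by auto
  qed
  have mono: "f s \<le> f r" if "1 \<le> r" "r \<le> s" for r s
  proof (cases "f s = 0")
    case False
    then have "(s, f s) \<in> Y" by (simp add: row)
    then have "(r, f s) \<in> Y" using down that False by simp
    then show ?thesis by (simp add: row)
  qed simp
  have fpos: "f r \<noteq> 0" if "1 \<le> r" "r \<le> m" for r
    using col[of r] row[of r 1] that by simp
  have "sorted_wrt (\<ge>) \<mu>"
    using mono by (auto simp: \<mu>_def sorted_wrt_iff_nth_less simp del: upt_Suc)
  moreover have "0 \<notin> set \<mu>"
    using fpos by (force simp: \<mu>_def simp del: upt_Suc)
  ultimately have "is_partition \<mu>"
    by (simp add: is_partition_def)
  moreover have "(r, c) \<in> young_diagram \<mu> \<longleftrightarrow> (r, c) \<in> Y" for r c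
  proof -
    have "row_len \<mu> r = (if 1 \<le> r \<and> r \<le> m then f r else 0)"
      by (auto simp: row_len_def \<mu>_def simp del: upt_Suc)
    moreover have "1 \<le> r \<and> r \<le> m" if "(r, c) \<in> Y"
    proof -
      have "1 \<le> r" "1 \<le> c" using pos[OF that] by auto
      then have "(r, 1) \<in> Y" using down[OF that, of r 1] by simp
      then show ?thesis using col by blast
    qed
    ultimately show ?thesis
      by (auto simp: in_young_diagram row split: if_splits)
  qed
  ultimately show ?thesis by auto
qed

lemma card_young_diagram: "card (young_diagram \<mu>) = sum_list \<mu>"
proof -
  have "young_diagram \<mu> = Sigma {1..length \<mu>} (\<lambda>r. {1..row_len \<mu> r})"
    by (auto simp: young_diagram_def)
  then have "card (young_diagram \<mu>) = (\<Sum>r = 1..length \<mu>. row_len \<mu> r)"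
    by (simp add: card_SigmaI)
  also have "\<dots> = (\<Sum>i<length \<mu>. \<mu> ! i)"
    by (rule sum.reindex_bij_witness[of _ Suc "\<lambda>r. r - 1"]) (auto simp: row_len_def)
  also have "\<dots> = sum_list \<mu>" by (simp add: sum_list_sum_nth atLeast0LessThan)
  finally show ?thesis .
qed

text \<open>In a weakly decreasing list all zeros are trailing, so dropping them does not renumber
  the rows of the positive entries. This makes \<open>cyclic_shift\<close> accessible box by
  box.\<close>

lemma young_diagram_filter_pos:
  assumes "sorted_wrt (\<ge>) L"
  shows "(r, c) \<in> young_diagram (filter (\<lambda>x. x > 0) L) \<longleftrightarrow>
    1 \<le> r \<and> r \<le> length L \<and> 1 \<le> c \<and> c \<le> L ! (r - 1)"
  using assms
proof (induction L arbitrary: r)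
  case Nil
  then show ?case by (auto simp: young_diagram_def)
next
  case (Cons x xs)
  show ?case
  proof (cases "x = 0")
    case True
    then have zero: "y = 0" if "y \<in> set (x # xs)" for y using Cons.prems that by auto
    then have "filter (\<lambda>x. x > 0) (x # xs) = []" by (simp add: filter_empty_conv)
    moreover have "(x # xs) ! (r - 1) = 0" if "1 \<le> r" "r \<le> length (x # xs)"
      using zero nth_mem[of "r - 1" "x # xs"] that by auto
    ultimately show ?thesis by (auto simp: young_diagram_def)
  next
    case False
    then have e: "filter (\<lambda>x. x > 0) (x # xs) = x # filter (\<lambda>x. x > 0) xs" by simp
    consider "r = 0" | "r = 1" | q where "r = Suc q" "1 \<le> q"
      by (metis One_nat_def Suc_le_eq not0_implies_Suc not_gr_zero)
    then show ?thesis
    proof cases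
      case 3
      then have "row_len (x # filter (\<lambda>x. x > 0) xs) r = row_len (filter (\<lambda>x. x > 0) xs) q"
        by (auto simp: row_len_def nth_Cons')
      then have "(r, c) \<in> young_diagram (x # filter (\<lambda>x. x > 0) xs) \<longleftrightarrow>
          (q, c) \<in> young_diagram (filter (\<lambda>x. x > 0) xs)"
        using 3 by (simp add: in_young_diagram)
      also have "\<dots> \<longleftrightarrow> 1 \<le> q \<and> q \<le> length xs \<and> 1 \<le> c \<and> c \<le> xs ! (q - 1)"
        using Cons by simp
      finally show ?thesis using 3 unfolding e by (simp add: nth_Cons')
    qed (use False in \<open>auto simp: e young_diagram_def row_len_def\<close>)
  qed
qed

lemma is_partition_filter_pos:
  "sorted_wrt (\<ge>) L \<Longrightarrow> is_partition (filter (\<lambda>x. x > 0) L)"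
  by (simp add: is_partition_def sorted_wrt_filter)

section \<open>The cyclic shift on Young diagrams\<close>

lemma bounded_hook_partitions_le:
  assumes "1 \<le> N"
  shows "\<mu> \<in> bounded_hook_partitions N \<longleftrightarrow>
    is_partition \<mu> \<and> (row_len \<mu> 1 + length \<mu> \<le> N)"
  using assms by (auto simp: bounded_hook_partitions_iff row_len_def)

text \<open>The shift deletes the first column, moves every other box one step down and one step
  left, and adds a first row. A surviving box thus moves by two diagonals, which is why the shift
  becomes a rotation by two.\<close>

lemma cyclic_shift_diagram:
  assumes "1 \<le> N" "\<mu> \<in> bounded_hook_partitions N"
  shows "is_partition (cyclic_shift N \<mu>)"
    and "(1, c) \<in> young_diagram (cyclic_shift N \<mu>) \<longleftrightarrow> 1 \<le> c \<and> c + length \<mu> + 1 \<le> N"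
    and "1 \<le> r \<Longrightarrow> 1 \<le> c \<Longrightarrow>
      (Suc r, c) \<in> young_diagram (cyclic_shift N \<mu>) \<longleftrightarrow> (r, Suc c) \<in> young_diagram \<mu>"
proof -
  let ?L = "(N - length \<mu> - 1) # map (\<lambda>x. x - 1) \<mu>"
  have p: "is_partition \<mu>" and le: "row_len \<mu> 1 + length \<mu> \<le> N"
    using assms by (auto simp: bounded_hook_partitions_le)
  \<comment> \<open>The hook bound makes the new first part at least as large as the reduced old
    ones, so the list stays weakly decreasing.\<close>
  have "x - 1 \<le> N - length \<mu> - 1" if x: "x \<in> set \<mu>" for x
  proof -
    obtain i where i: "i < length \<mu>" "x = \<mu> ! i" using x by (auto simp: in_set_conv_nth)
    then have "row_len \<mu> (Suc i) = x" by (simp add: row_len_def)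
    then have "x \<le> row_len \<mu> 1"
      using row_len_antimono[OF p, of 1 "Suc i"] by linarith
    then show ?thesis using le by linarith
  qed
  moreover have "sorted_wrt (\<ge>) (map (\<lambda>x. x - 1) \<mu>)"
    using p by (auto simp: is_partition_def sorted_wrt_iff_nth_less intro: diff_le_mono)
  ultimately have s: "sorted_wrt (\<ge>) ?L" by auto
  show "is_partition (cyclic_shift N \<mu>)"
    unfolding cyclic_shift_def by (rule is_partition_filter_pos[OF s])
  note yd = young_diagram_filter_pos[OF s, folded cyclic_shift_def]
  show "(1, c) \<in> young_diagram (cyclic_shift N \<mu>) \<longleftrightarrow> 1 \<le> c \<and> c + length \<mu> + 1 \<le> N"
    by (auto simp: yd)
  show "(Suc r, c) \<in> young_diagram (cyclic_shift N \<mu>) \<longleftrightarrow> (r, Suc c) \<in> young_diagram \<mu>"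
    if "1 \<le> r" "1 \<le> c"
    using that by (auto simp: yd in_young_diagram[of _ _ \<mu>] row_len_def nth_Cons')
qed

section \<open>Partitions between two staircases\<close>

text \<open>Its boxes form the diagram of the partition \<open>(k - 1, \<dots>, 1)\<close>, so the
  index is one more than the number of rows when \<open>k \<ge> 1\<close>.\<close>

definition staircase :: "nat \<Rightarrow> (nat \<times> nat) set" where
  "staircase k = {(r, c). 1 \<le> r \<and> 1 \<le> c \<and> r + c \<le> k}"

text \<open>For \<open>s \<le> 2 * k\<close> this is the box on the diagonal \<open>c - r = s - k\<close> with \<open>r + c = k + 2\<close> for even
  \<open>s\<close> and \<open>r + c = k + 1\<close> for odd \<open>s\<close>.\<close>

definition free_box :: "nat \<Rightarrow> nat \<Rightarrow> nat \<times> nat" where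
  "free_box k s = ((if even s then k + 1 else k) - s div 2, s div 2 + 1)"

text \<open>A description of the inner partitions that mentions neither rims nor the metric. The
  exclusion of the two end boxes is what remains of the hook length bound: first row and first
  column may not both have length \<open>k + 1\<close>.\<close>

definition near_staircase :: "nat \<Rightarrow> nat list set" where
  "near_staircase k = {\<mu>. is_partition \<mu> \<and> staircase k \<subseteq> young_diagram \<mu> \<and>
     young_diagram \<mu> \<subseteq> staircase (k + 2) \<and>
     \<not> ((1, k + 1) \<in> young_diagram \<mu> \<and> (k + 1, 1) \<in> young_diagram \<mu>)}"

text \<open>The diagonals on which the outer rim meets a site at distance \<open>2 * (k - 1)\<close>.\<close>

definition extremal :: "nat \<Rightarrow> nat list \<Rightarrow> nat set" where
  "extremal k \<mu> = {s. s \<le> 2 * k \<and> (free_box k s \<in> young_diagram \<mu> \<longleftrightarrow> even s)}"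

text \<open>Independent sets of the cycle with vertices \<open>0, \<dots>, 2 * k\<close>. For
  \<open>k = 0\<close> the cycle is a loop, and only the empty set qualifies.\<close>

definition cycle_independent :: "nat \<Rightarrow> nat set \<Rightarrow> bool" where
  "cycle_independent k X \<longleftrightarrow> X \<subseteq> {..2 * k} \<and> (\<forall>s \<in> X. Suc s mod (2 * k + 1) \<notin> X)"

section \<open>Diagrams and independent sets of the cycle\<close>

lemma free_box_even: "free_box k (2 * q) = (k + 1 - q, q + 1)"
  and free_box_odd: "free_box k (Suc (2 * q)) = (k - q, q + 1)"
  by (simp_all add: free_box_def)

lemma free_box_cases:
  assumes "s \<le> 2 * k"
  obtains (even) q where "s = 2 * q" "q \<le> k" "free_box k s = (k + 1 - q, q + 1)"
  | (odd) q where "s = Suc (2 * q)" "q < k" "free_box k s = (k - q, q + 1)"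
proof (cases "even s")
  case True
  then obtain q where "s = 2 * q" by (auto elim: evenE)
  then show ?thesis using assms even[of q] free_box_even by simp
next
  case False
  then obtain q where "s = Suc (2 * q)" by (auto elim: oddE)
  then show ?thesis using assms odd[of q] free_box_odd by simp
qed

text \<open>The difference of the staircases consists of two antidiagonals: the \<open>k + 1\<close>
  boxes with \<open>r + c = k + 2\<close> have the even indices, the \<open>k\<close> boxes with
  \<open>r + c = k + 1\<close> the odd ones.\<close>

lemma free_box_range: "free_box k ` {..2 * k} = staircase (k + 2) - staircase k"
proof
  show "free_box k ` {..2 * k} \<subseteq> staircase (k + 2) - staircase k"
  proof
    fix b assume "b \<in> free_box k ` {..2 * k}"
    then obtain s where "s \<le> 2 * k" "b = free_box k s" by auto
    then show "b \<in> staircase (k + 2) - staircase k"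
      by (cases rule: free_box_cases[of s k]) (auto simp: staircase_def)
  qed
  show "staircase (k + 2) - staircase k \<subseteq> free_box k ` {..2 * k}"
  proof
    fix b assume b: "b \<in> staircase (k + 2) - staircase k"
    obtain r c where rc: "b = (r, c)" by (cases b)
    with b consider "r + c = k + 2" "1 \<le> r" "1 \<le> c" | "r + c = k + 1" "1 \<le> r" "1 \<le> c"
      by (force simp: staircase_def)
    then show "b \<in> free_box k ` {..2 * k}"
    proof cases
      case 1
      then have "b = free_box k (2 * (c - 1))" "2 * (c - 1) \<le> 2 * k"
        unfolding rc free_box_even by auto
      then show ?thesis by blast
    next
      case 2
      then have "b = free_box k (Suc (2 * (c - 1)))" "Suc (2 * (c - 1)) \<le> 2 * k"
        unfolding rc free_box_odd by auto
      then show ?thesis by blast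
    qed
  qed
qed

lemma inj_on_free_box: "inj_on (free_box k) {..2 * k}"
proof (rule inj_onI)
  fix s t assume st: "s \<in> {..2 * k}" "t \<in> {..2 * k}" "free_box k s = free_box k t"
  then have s: "s \<le> 2 * k" and t: "t \<le> 2 * k" by auto
  show "s = t"
    by (rule free_box_cases[OF s]; rule free_box_cases[OF t]) (use st(3) in auto)
qed

lemma free_box_in_staircase:
  assumes "s \<le> 2 * k"
  shows "free_box k s \<in> staircase (k + 2)" "free_box k s \<notin> staircase k"
  using free_box_range[of k] assms by auto

lemma near_staircase_diagram:
  assumes "\<mu> \<in> near_staircase k"
  shows "young_diagram \<mu> =
    staircase k \<union> free_box k ` {s. s \<le> 2 * k \<and> (s \<in> extremal k \<mu> \<longleftrightarrow> even s)}"
proof -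
  have "young_diagram \<mu> = staircase k \<union> {b \<in> free_box k ` {..2 * k}. b \<in> young_diagram \<mu>}"
    using assms unfolding free_box_range near_staircase_def by blast
  also have "{b \<in> free_box k ` {..2 * k}. b \<in> young_diagram \<mu>} =
      free_box k ` {s. s \<le> 2 * k \<and> (s \<in> extremal k \<mu> \<longleftrightarrow> even s)}"
    by (auto simp: extremal_def)
  finally show ?thesis .
qed

lemma extremal_le: "s \<in> extremal k \<mu> \<Longrightarrow> s \<le> 2 * k"
  by (simp add: extremal_def)

lemma inj_on_extremal: "inj_on (extremal k) (near_staircase k)"
proof (rule inj_onI)
  fix \<mu> \<nu> assume "\<mu> \<in> near_staircase k" "\<nu> \<in> near_staircase k" "extremal k \<mu> = extremal k \<nu>"
  moreover from this have "young_diagram \<mu> = young_diagram \<nu>"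
    by (simp add: near_staircase_diagram)
  ultimately show "\<mu> = \<nu>"
    by (intro young_diagram_inj) (simp_all add: near_staircase_def)
qed

text \<open>A free box of even index lies immediately below or to the right of its odd neighbours.
  Hence a present even box forces its odd neighbours to be present, so these are not
  extremal.\<close>

lemma cycle_independent_extremal:
  assumes "\<mu> \<in> near_staircase k"
  shows "cycle_independent k (extremal k \<mu>)"
  unfolding cycle_independent_def
proof (intro conjI ballI notI)
  show "extremal k \<mu> \<subseteq> {..2 * k}" by (auto simp: extremal_def)
  fix s assume s: "s \<in> extremal k \<mu>" and s': "Suc s mod (2 * k + 1) \<in> extremal k \<mu>"
  note down = young_diagram_downward[of \<mu>]
  have p: "is_partition \<mu>" using assms by (simp add: near_staircase_def)
  have "s \<le> 2 * k" using s by (rule extremal_le)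
  show False
  \<comment> \<open>The pair \<open>2 * k\<close>, \<open>0\<close> that closes the cycle consists
    of the two end boxes \<open>(1, k + 1)\<close> and \<open>(k + 1, 1)\<close>, which do not both
    occur.\<close>
  proof (cases "s = 2 * k")
    case True
    then have "free_box k (2 * k) \<in> young_diagram \<mu>" "free_box k (2 * 0) \<in> young_diagram \<mu>"
      using s s' by (auto simp: extremal_def)
    then show False
      using assms unfolding free_box_even by (auto simp: near_staircase_def)
  next
    case False
    then have s'': "Suc s \<in> extremal k \<mu>" using s' \<open>s \<le> 2 * k\<close> by simp
    from \<open>s \<le> 2 * k\<close> show False
    proof (cases rule: free_box_cases)
      case (even q)
      have "(k + 1 - q, q + 1) \<in> young_diagram \<mu>" "(k - q, q + 1) \<notin> young_diagram \<mu>"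
        using s s'' even free_box_odd[of k q] by (auto simp: extremal_def)
      moreover have "1 \<le> k - q" using even s'' by (auto simp: extremal_def)
      moreover have "k - q \<le> k + 1 - q" by (rule diff_le_mono) simp
      ultimately show False using down[OF p, of "k + 1 - q" "q + 1" "k - q" "q + 1"] by simp
    next
      case (odd q)
      have "(k - q, q + 1) \<notin> young_diagram \<mu>" "(k + 1 - (q + 1), q + 2) \<in> young_diagram \<mu>"
        using s s'' odd free_box_even[of k "q + 1"] by (auto simp: extremal_def)
      moreover have "1 \<le> k - q" using odd(2) by simp
      ultimately show False using down[OF p, of "k + 1 - (q + 1)" "q + 2" "k - q" "q + 1"] by auto
    qed
  qed
qed

text \<open>The set \<open>X\<close> prescribes which free boxes are present. Independence is what
  makes the resulting set of boxes closed under moving up and left, and what excludes the two end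
  boxes from occurring together.\<close>

lemma extremal_surj:
  assumes X: "cycle_independent k X"
  shows "\<exists>\<mu> \<in> near_staircase k. extremal k \<mu> = X"
proof -
  define W where "W = {s. s \<le> 2 * k \<and> (s \<in> X \<longleftrightarrow> even s)}"
  define Y where "Y = staircase k \<union> free_box k ` W"
  have XS: "s \<le> 2 * k" "Suc s mod (2 * k + 1) \<notin> X" if "s \<in> X" for s
    using X that by (auto simp: cycle_independent_def)
  have W: "W \<subseteq> {..2 * k}" by (auto simp: W_def)
  then have fW: "free_box k ` W \<subseteq> staircase (k + 2) - staircase k"
    unfolding free_box_range[symmetric] by blast
  then have YS: "Y \<subseteq> staircase (k + 2)" by (auto simp: Y_def staircase_def)
  have mem: "free_box k s \<in> Y \<longleftrightarrow> s \<in> W" if "s \<le> 2 * k" for s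
    using that W free_box_in_staircase inj_on_image_mem_iff[OF inj_on_free_box, of s k W]
    by (auto simp: Y_def)
  have fin: "finite Y"
    by (rule finite_subset[OF YS], rule finite_subset[of _ "{..k + 2} \<times> {..k + 2}"])
      (auto simp: staircase_def)
  have down: "(r', c') \<in> Y"
    if rc: "(r, c) \<in> Y" and le: "1 \<le> r'" "r' \<le> r" "1 \<le> c'" "c' \<le> c" for r c r' c'
  proof (cases "r' + c' \<le> k")
    case True
    then show ?thesis using le by (auto simp: Y_def staircase_def)
  next
    case False
    have "r + c \<le> k + 2" using rc YS by (auto simp: staircase_def)
    show ?thesis
    proof (cases "r' = r \<and> c' = c")
      case True
      then show ?thesis using rc by simp
    next
      case neq: False
      \<comment> \<open>Two distinct comparable boxes outside the smaller staircase are one step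
        apart, on the two antidiagonals. The larger one has an even index in \<open>X\<close>; the
        smaller one has a neighbouring odd index, which independence keeps out of \<open>X\<close>,
        so its box is present.\<close>
      have sum: "r + c = k + 2" "r' + c' = k + 1"
        using \<open>r + c \<le> k + 2\<close> False neq le by linarith+
      have rc_eq: "(r, c) = free_box k (2 * (c - 1))" unfolding free_box_even using sum le by auto
      have "2 * (c - 1) \<in> W" using mem[of "2 * (c - 1)"] rc rc_eq sum le by auto
      then have cX: "2 * (c - 1) \<in> X" by (auto simp: W_def)
      show ?thesis
      \<comment> \<open>The box above has the next index, the box to the left the preceding
        one.\<close>
      proof (cases "c' = c")
        case True
        then have e: "(r', c') = free_box k (Suc (2 * (c - 1)))" and b: "Suc (2 * (c - 1)) \<le> 2 * k"
          unfolding free_box_odd using sum le by auto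
        have "Suc (2 * (c - 1)) \<notin> X" using XS[OF cX] b by simp
        then have "Suc (2 * (c - 1)) \<in> W" using b by (simp add: W_def)
        then show ?thesis using e mem[OF b] by simp
      next
        case False
        then have e: "(r', c') = free_box k (Suc (2 * (c' - 1)))"
          and b: "Suc (2 * (c' - 1)) \<le> 2 * k" and c: "2 * (c - 1) = Suc (Suc (2 * (c' - 1)))"
          unfolding free_box_odd using sum le by auto
        have "Suc (2 * (c' - 1)) \<notin> X"
          using XS(2)[of "Suc (2 * (c' - 1))"] cX XS(1)[OF cX] unfolding c by auto
        then have "Suc (2 * (c' - 1)) \<in> W" using b by (simp add: W_def)
        then show ?thesis using e mem[OF b] by simp
      qed
    qed
  qed
  have "\<exists>\<mu>. is_partition \<mu> \<and> young_diagram \<mu> = Y"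
    by (rule partition_of_young_diagram[OF fin _ down]) (use YS in \<open>auto simp: staircase_def\<close>)
  then obtain \<mu> where p: "is_partition \<mu>" and \<mu>: "young_diagram \<mu> = Y" by blast
  have "\<not> ((1, k + 1) \<in> Y \<and> (k + 1, 1) \<in> Y)"
  proof
    assume "(1, k + 1) \<in> Y \<and> (k + 1, 1) \<in> Y"
    then have "free_box k (2 * k) \<in> Y" "free_box k (2 * 0) \<in> Y"
      unfolding free_box_even by auto
    then have "2 * k \<in> X" "0 \<in> X" using mem[of "2 * k"] mem[of "2 * 0"] by (auto simp: W_def)
    then show False using XS(2)[of "2 * k"] by simp
  qed
  then have "\<mu> \<in> near_staircase k"
    using p YS by (auto simp: near_staircase_def \<mu> Y_def)
  moreover have "extremal k \<mu> = X"
    using XS mem by (auto simp: extremal_def \<mu> W_def)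
  ultimately show ?thesis by blast
qed

lemma bij_betw_extremal: "bij_betw (extremal k) (near_staircase k) {X. cycle_independent k X}"
proof (rule bij_betw_imageI[OF inj_on_extremal])
  show "extremal k ` near_staircase k = {X. cycle_independent k X}"
  proof
    show "extremal k ` near_staircase k \<subseteq> {X. cycle_independent k X}"
      using cycle_independent_extremal by blast
    show "{X. cycle_independent k X} \<subseteq> extremal k ` near_staircase k"
      using extremal_surj by fastforce
  qed
qed

section \<open>Intervals and removal of inner corners\<close>

lemma cycle_independent_subset:
  "cycle_independent k X \<Longrightarrow> Y \<subseteq> X \<Longrightarrow> cycle_independent k Y"
  by (auto simp: cycle_independent_def)

lemma near_staircase_interval:
  assumes "\<mu> \<in> near_staircase k" "\<mu>' \<in> near_staircase k"
  shows "young_interval \<mu>' \<mu> \<subseteq> near_staircase k"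
  using assms by (auto simp: young_interval_def near_staircase_def)

text \<open>Where the two diagrams agree on a free box, every partition between them agrees too.
  Where they differ, the index lies in exactly one of the two extremal sets and can be chosen
  freely; independence of the union makes every choice realizable.\<close>

lemma extremal_interval:
  assumes \<mu>: "\<mu> \<in> near_staircase k" and \<mu>': "\<mu>' \<in> near_staircase k"
    and le: "young_diagram \<mu>' \<subseteq> young_diagram \<mu>"
    and ind: "cycle_independent k (extremal k \<mu> \<union> extremal k \<mu>')"
  shows "extremal k ` young_interval \<mu>' \<mu> =
    {X. extremal k \<mu> \<inter> extremal k \<mu>' \<subseteq> X \<and> X \<subseteq> extremal k \<mu> \<union> extremal k \<mu>'}"
proof (intro equalityI subsetI)
  fix X assume "X \<in> extremal k ` young_interval \<mu>' \<mu>"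
  then obtain \<nu> where X: "X = extremal k \<nu>" and "young_diagram \<mu>' \<subseteq> young_diagram \<nu>"
      "young_diagram \<nu> \<subseteq> young_diagram \<mu>"
    by (auto simp: young_interval_def)
  then have le': "free_box k s \<in> young_diagram \<mu>' \<Longrightarrow> free_box k s \<in> young_diagram \<nu>"
      "free_box k s \<in> young_diagram \<nu> \<Longrightarrow> free_box k s \<in> young_diagram \<mu>" for s
    by blast+
  have "s \<in> extremal k \<nu>" if "s \<in> extremal k \<mu>" "s \<in> extremal k \<mu>'" for s
    using that le'[of s] by (auto simp: extremal_def)
  moreover have "s \<in> extremal k \<mu> \<or> s \<in> extremal k \<mu>'" if "s \<in> extremal k \<nu>" for s
    using that le'[of s] by (auto simp: extremal_def)
  ultimately show "X \<in> {X. extremal k \<mu> \<inter> extremal k \<mu>' \<subseteq> X \<and> X \<subseteq> extremal k \<mu> \<union> extremal k \<mu>'}"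
    unfolding X by blast
next
  fix X assume "X \<in> {X. extremal k \<mu> \<inter> extremal k \<mu>' \<subseteq> X \<and> X \<subseteq> extremal k \<mu> \<union> extremal k \<mu>'}"
  then have X: "extremal k \<mu> \<inter> extremal k \<mu>' \<subseteq> X" "X \<subseteq> extremal k \<mu> \<union> extremal k \<mu>'" by auto
  obtain \<nu> where \<nu>: "\<nu> \<in> near_staircase k" "extremal k \<nu> = X"
    using extremal_surj[OF cycle_independent_subset[OF ind X(2)]] by blast
  have box: "free_box k s \<in> young_diagram \<mu>'' \<longleftrightarrow> (s \<in> extremal k \<mu>'' \<longleftrightarrow> even s)"
    if "s \<le> 2 * k" for s \<mu>''
    using that by (auto simp: extremal_def)
  have free: "(s \<in> extremal k \<mu>' \<longleftrightarrow> even s) \<Longrightarrow> (s \<in> extremal k \<mu> \<longleftrightarrow> even s)"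
    if "s \<le> 2 * k" for s
    using le box[OF that] by blast
  have "young_diagram \<mu>' \<subseteq> young_diagram \<nu>" "young_diagram \<nu> \<subseteq> young_diagram \<mu>"
    unfolding near_staircase_diagram[OF \<mu>] near_staircase_diagram[OF \<mu>']
      near_staircase_diagram[OF \<nu>(1)] \<nu>(2)
    using free X by (intro Un_mono image_mono subset_refl; blast)+
  moreover have "is_partition \<nu>" using \<nu> by (simp add: near_staircase_def)
  ultimately show "X \<in> extremal k ` young_interval \<mu>' \<mu>"
    using \<nu>(2) by (auto simp: young_interval_def)
qed

text \<open>Removing a free box toggles its index, so the symmetric difference of the extremal sets
  counts the removed boxes. A consecutive pair in the union would either lie in one of the two
  independent sets or belong to two removed boxes.\<close>

lemma removes_corners_extremal:
  assumes \<mu>: "\<mu> \<in> near_staircase k" and \<mu>': "\<mu>' \<in> near_staircase k"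
    and rem: "removes_corners v \<mu> \<mu>'"
  shows "young_diagram \<mu>' \<subseteq> young_diagram \<mu>"
    and "cycle_independent k (extremal k \<mu> \<union> extremal k \<mu>')"
    and "card ((extremal k \<mu> \<union> extremal k \<mu>') - (extremal k \<mu> \<inter> extremal k \<mu>')) = v"
proof -
  let ?X = "extremal k \<mu>" and ?X' = "extremal k \<mu>'"
  obtain B where B: "B \<subseteq> inner_corners \<mu>" "card B = v"
      "young_diagram \<mu>' = young_diagram \<mu> - B"
    using rem by (auto simp: removes_corners_def)
  then have BY: "B \<subseteq> young_diagram \<mu>" by (auto simp: inner_corners_def)
  show le: "young_diagram \<mu>' \<subseteq> young_diagram \<mu>" using B by blast
  define J where "J = (?X \<union> ?X') - (?X \<inter> ?X')"
  have J: "J = {s. s \<le> 2 * k \<and> free_box k s \<in> B}"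
    using B(3) BY by (auto simp: J_def extremal_def)
  have "B = young_diagram \<mu> - young_diagram \<mu>'" using B BY by blast
  then have "B \<subseteq> staircase (k + 2) - staircase k"
    using \<mu> \<mu>' unfolding near_staircase_def by blast
  then have "free_box k ` J = B"
    unfolding free_box_range[symmetric] J by auto
  moreover have "inj_on (free_box k) J"
    by (rule inj_on_subset[OF inj_on_free_box]) (auto simp: J)
  ultimately show "card ((?X \<union> ?X') - (?X \<inter> ?X')) = v"
    using card_image B(2) unfolding J_def by metis
  \<comment> \<open>No other box of the diagram lies weakly below and to the right of an inner
    corner, since removing the corner must leave a diagram.\<close>
  have corner: "b \<notin> young_diagram \<mu>"
    if "a \<in> B" "b \<noteq> a" "fst a \<le> fst b" "snd a \<le> snd b" for a b
  proof
    assume b: "b \<in> young_diagram \<mu>"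
    obtain \<rho> where \<rho>: "is_partition \<rho>" "young_diagram \<rho> = young_diagram \<mu> - {a}"
      using B(1) \<open>a \<in> B\<close> by (auto simp: inner_corners_def)
    have "a \<in> young_diagram \<mu>" using BY \<open>a \<in> B\<close> by blast
    then have "1 \<le> fst a" "1 \<le> snd a" by (auto simp: young_diagram_def)
    then have "a \<in> young_diagram \<rho>"
      using young_diagram_downward[OF \<rho>(1), of "fst b" "snd b" "fst a" "snd a"] \<rho>(2) b that by auto
    then show False using \<rho>(2) by simp
  qed
  \<comment> \<open>Of two consecutive free boxes the odd one is immediately above or to the left of
    the even one, hence not a corner while that is present. For the pair closing the cycle the
    condition on the end boxes applies.\<close>
  have nadj: "\<not> (s \<in> J \<and> Suc s mod (2 * k + 1) \<in> J)" for s
  proof (cases "s < 2 * k")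
    case True
    then have s: "s \<le> 2 * k" by simp
    then show ?thesis
    proof (cases rule: free_box_cases)
      case (even q)
      then show ?thesis
        using corner[of "free_box k (Suc s)" "free_box k s"] BY True free_box_odd[of k q]
        by (auto simp: J Suc_diff_le)
    next
      case (odd q)
      then show ?thesis
        using corner[of "free_box k s" "free_box k (Suc s)"] BY True free_box_even[of k "q + 1"]
        by (auto simp: J)
    qed
  next
    case False
    show ?thesis
    proof
      assume "s \<in> J \<and> Suc s mod (2 * k + 1) \<in> J"
      moreover from this have "s = 2 * k" using False by (auto simp: J)
      ultimately have "free_box k (2 * k) \<in> young_diagram \<mu>" "free_box k (2 * 0) \<in> young_diagram \<mu>"
        using BY by (auto simp: J)
      then show False
        using \<mu> unfolding free_box_even by (auto simp: near_staircase_def)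
    qed
  qed
  show "cycle_independent k (?X \<union> ?X')"
    unfolding cycle_independent_def
  proof (intro conjI ballI notI)
    show "?X \<union> ?X' \<subseteq> {..2 * k}" by (auto simp: extremal_def)
    fix s assume "s \<in> ?X \<union> ?X'" "Suc s mod (2 * k + 1) \<in> ?X \<union> ?X'"
    then show False
      using nadj[of s] cycle_independent_extremal[OF \<mu>] cycle_independent_extremal[OF \<mu>']
      by (auto simp: cycle_independent_def J_def)
  qed
qed

text \<open>All sets between \<open>S'\<close> and \<open>S\<close> are independent and so come from
  partitions. The even indices of \<open>J\<close> join the larger partition and the odd ones the
  smaller, so that every free box with index in \<open>J\<close> is present in the larger and absent
  in the smaller.\<close>

lemma removes_corners_surj:
  assumes S: "cycle_independent k S" and S': "S' \<subseteq> S"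
  shows "\<exists>\<mu> \<in> near_staircase k. \<exists>\<mu>' \<in> near_staircase k. removes_corners (card (S - S')) \<mu> \<mu>' \<and>
    extremal k \<mu> \<union> extremal k \<mu>' = S \<and> extremal k \<mu> \<inter> extremal k \<mu>' = S'"
proof -
  define J where "J = S - S'"
  define X where "X = S' \<union> {s \<in> J. even s}"
  define X' where "X' = S' \<union> {s \<in> J. odd s}"
  have sub: "X \<subseteq> S" "X' \<subseteq> S" using S' by (auto simp: X_def X'_def J_def)
  obtain \<mu> where \<mu>: "\<mu> \<in> near_staircase k" "extremal k \<mu> = X"
    using extremal_surj[OF cycle_independent_subset[OF S sub(1)]] by blast
  obtain \<mu>' where \<mu>': "\<mu>' \<in> near_staircase k" "extremal k \<mu>' = X'"
    using extremal_surj[OF cycle_independent_subset[OF S sub(2)]] by blast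
  have J: "J \<subseteq> {..2 * k}" using S by (auto simp: J_def cycle_independent_def)
  \<comment> \<open>Membership of an index of \<open>J\<close> in \<open>X\<close> amounts to its
    being even, that is, to its free box being present; toggling it removes the box.\<close>
  have toggle: "young_diagram \<nu> = young_diagram \<mu> - free_box k ` K"
    if \<nu>: "\<nu> \<in> near_staircase k" "extremal k \<nu> = (X - K) \<union> (K - X)" and K: "K \<subseteq> J" for \<nu> K
  proof -
    have K': "K \<subseteq> {..2 * k}" using K J by blast
    have K_even: "s \<in> X \<longleftrightarrow> even s" if "s \<in> K" for s
      using that K by (auto simp: X_def J_def)
    have st: "free_box k ` K \<inter> staircase k = {}"
      using K' free_box_in_staircase(2) by blast
    let ?W = "{s. s \<le> 2 * k \<and> (s \<in> X \<longleftrightarrow> even s)}"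
    have "young_diagram \<mu> - free_box k ` K = staircase k \<union> (free_box k ` ?W - free_box k ` K)"
      unfolding near_staircase_diagram[OF \<mu>(1)] \<mu>(2) using st by blast
    also have "free_box k ` ?W - free_box k ` K = free_box k ` (?W - K)"
      using K' by (intro inj_on_image_set_diff[OF inj_on_free_box, symmetric]) auto
    also have "?W - K = {s. s \<le> 2 * k \<and> (s \<in> extremal k \<nu> \<longleftrightarrow> even s)}"
      using K_even unfolding \<nu>(2) by auto
    finally show ?thesis using near_staircase_diagram[OF \<nu>(1)] by simp
  qed
  have "young_diagram \<mu>' = young_diagram \<mu> - free_box k ` J"
    by (rule toggle[OF \<mu>'(1)]) (use S' in \<open>auto simp: \<mu>' X_def X'_def J_def\<close>)
  moreover have "free_box k ` J \<subseteq> inner_corners \<mu>"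
  proof
    fix b assume "b \<in> free_box k ` J"
    then obtain s where s: "s \<in> J" "b = free_box k s" by blast
    \<comment> \<open>Toggling a single index stays inside \<open>S\<close>, hence removing the
      single box leaves a partition: the box is an inner corner.\<close>
    have "(X - {s}) \<union> ({s} - X) \<subseteq> S" using sub s by (auto simp: J_def)
    then obtain \<nu> where \<nu>: "\<nu> \<in> near_staircase k" "extremal k \<nu> = (X - {s}) \<union> ({s} - X)"
      using extremal_surj[OF cycle_independent_subset[OF S]] by blast
    have "young_diagram \<nu> = young_diagram \<mu> - {b}"
      using toggle[OF \<nu>] s by simp
    moreover have "is_partition \<nu>" using \<nu> by (simp add: near_staircase_def)
    moreover have "b \<in> young_diagram \<mu>"
      unfolding near_staircase_diagram[OF \<mu>(1)] \<mu>(2) using s J by (auto simp: X_def J_def)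
    ultimately show "b \<in> inner_corners \<mu>" by (auto simp: inner_corners_def)
  qed
  moreover have "card (free_box k ` J) = card J"
    by (rule card_image) (rule inj_on_subset[OF inj_on_free_box J])
  ultimately have "removes_corners (card (S - S')) \<mu> \<mu>'"
    unfolding removes_corners_def J_def by blast
  moreover have "X \<union> X' = S" "X \<inter> X' = S'" using S' by (auto simp: X_def X'_def J_def)
  ultimately show ?thesis using \<mu> \<mu>' by blast
qed

section \<open>The cyclic shift between two staircases\<close>

lemma in_first_row: "(1, c) \<in> young_diagram \<mu> \<longleftrightarrow> 1 \<le> c \<and> c \<le> row_len \<mu> 1"
  by (simp add: in_young_diagram)

lemma in_first_column:
  "is_partition \<mu> \<Longrightarrow> (r, 1) \<in> young_diagram \<mu> \<longleftrightarrow> 1 \<le> r \<and> r \<le> length \<mu>"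
  using row_len_pos_iff[of \<mu> r] by (auto simp: in_young_diagram)

lemma near_staircase_lengths:
  assumes "\<mu> \<in> near_staircase k"
  shows "k - 1 \<le> row_len \<mu> 1" "row_len \<mu> 1 \<le> k + 1" "k - 1 \<le> length \<mu>" "length \<mu> \<le> k + 1"
    "row_len \<mu> 1 + length \<mu> \<le> 2 * k + 1"
proof -
  have p: "is_partition \<mu>" using assms by (simp add: near_staircase_def)
  note row = in_first_row[of _ \<mu>] and col = in_first_column[OF p]
  have st: "(r, c) \<in> young_diagram \<mu>" if "1 \<le> r" "1 \<le> c" "r + c \<le> k" for r c
    using assms that by (auto simp: near_staircase_def staircase_def)
  have st': "r + c \<le> k + 2" if "(r, c) \<in> young_diagram \<mu>" for r c
    using assms that by (auto simp: near_staircase_def staircase_def)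
  show "k - 1 \<le> row_len \<mu> 1"
  proof (cases "k - 1 \<ge> 1")
    case True
    then show ?thesis using row[of "k - 1"] st[of 1 "k - 1"] by simp
  qed simp
  show "k - 1 \<le> length \<mu>"
  proof (cases "k - 1 \<ge> 1")
    case True
    then show ?thesis using col[of "k - 1"] st[of "k - 1" 1] by simp
  qed simp
  show l: "row_len \<mu> 1 \<le> k + 1"
    using row[of "row_len \<mu> 1"] st'[of 1 "row_len \<mu> 1"] by (cases "row_len \<mu> 1 = 0") auto
  show m: "length \<mu> \<le> k + 1"
    using col[of "length \<mu>"] st'[of "length \<mu>" 1] by (cases "length \<mu> = 0") auto
  have "\<not> (k + 1 \<le> row_len \<mu> 1 \<and> k + 1 \<le> length \<mu>)"
    using assms row[of "k + 1"] col[of "k + 1"] by (auto simp: near_staircase_def)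
  then show "row_len \<mu> 1 + length \<mu> \<le> 2 * k + 1" using l m by linarith
qed

lemma near_staircase_bounded_hook:
  "\<mu> \<in> near_staircase k \<Longrightarrow> \<mu> \<in> bounded_hook_partitions (2 * k + 1)"
  using near_staircase_lengths[of \<mu> k]
  by (subst bounded_hook_partitions_le) (auto simp: near_staircase_def)

text \<open>Moving by two diagonals carries the free box of index \<open>s + 2\<close> to that of
  index \<open>s\<close>. The new first row meets the last two diagonals, which correspond to
  \<open>0\<close> and \<open>1\<close> after wrapping around. As \<open>N\<close> is odd, parity
  changes there, in accordance with the fact that a box is present in the new row iff one is absent
  from the old first column.\<close>

lemma cyclic_shift_near_staircase:
  assumes \<mu>: "\<mu> \<in> near_staircase k"
  shows "cyclic_shift (2 * k + 1) \<mu> \<in> near_staircase k" (is "?\<nu> \<in> _")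
    and "s \<le> 2 * k \<Longrightarrow> s \<in> extremal k (cyclic_shift (2 * k + 1) \<mu>) \<longleftrightarrow>
      (s + 2) mod (2 * k + 1) \<in> extremal k \<mu>"
proof -
  have p: "is_partition \<mu>" and st: "(r, c) \<in> young_diagram \<mu> \<Longrightarrow> r + c \<le> k + 2"
    and st': "1 \<le> r \<Longrightarrow> 1 \<le> c \<Longrightarrow> r + c \<le> k \<Longrightarrow> (r, c) \<in> young_diagram \<mu>" for r c
    using \<mu> by (auto simp: near_staircase_def staircase_def)
  note len = near_staircase_lengths[OF \<mu>]
  note shift = cyclic_shift_diagram[OF _ near_staircase_bounded_hook[OF \<mu>], simplified]
  have first: "(1, c) \<in> young_diagram ?\<nu> \<longleftrightarrow> 1 \<le> c \<and> c + length \<mu> \<le> 2 * k" for c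
    using shift(2)[of c] by auto
  have later: "(r + 1, c) \<in> young_diagram ?\<nu> \<longleftrightarrow> (r, c + 1) \<in> young_diagram \<mu>"
    if "1 \<le> r" "1 \<le> c" for r c
    using shift(3)[of r c] that by auto
  note col = in_first_column[OF p]
  have "staircase k \<subseteq> young_diagram ?\<nu>"
  proof
    fix b assume "b \<in> staircase k"
    then obtain r c where b: "b = (r, c)" "1 \<le> r" "1 \<le> c" "r + c \<le> k" by (auto simp: staircase_def)
    show "b \<in> young_diagram ?\<nu>"
    proof (cases "r = 1")
      case True
      then show ?thesis unfolding b(1) using first[of c] b len by auto
    next
      case False
      then show ?thesis unfolding b(1) using later[of "r - 1" c] st'[of "r - 1" "c + 1"] b by auto
    qed
  qed
  moreover have "young_diagram ?\<nu> \<subseteq> staircase (k + 2)"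
  proof
    fix b assume b': "b \<in> young_diagram ?\<nu>"
    then obtain r c where b: "b = (r, c)" "1 \<le> r" "1 \<le> c"
      by (auto simp: young_diagram_def)
    have "r + c \<le> k + 2"
    proof (cases "r = 1")
      case True
      then show ?thesis using first[of c] b b' len by auto
    next
      case False
      then show ?thesis using later[of "r - 1" c] st[of "r - 1" "c + 1"] b b' by auto
    qed
    then show "b \<in> staircase (k + 2)" using b by (auto simp: staircase_def)
  qed
  moreover have "\<not> ((1, k + 1) \<in> young_diagram ?\<nu> \<and> (k + 1, 1) \<in> young_diagram ?\<nu>)"
  proof
    \<comment> \<open>The first box requires fewer than \<open>k\<close> rows in
      \<open>\<mu>\<close>, whereas the second comes from the box \<open>(k, 2)\<close> in row
      \<open>k\<close>.\<close>
    assume a: "(1, k + 1) \<in> young_diagram ?\<nu> \<and> (k + 1, 1) \<in> young_diagram ?\<nu>"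
    then have m: "length \<mu> + 1 \<le> k" using first[of "k + 1"] by auto
    then have "(k, 2) \<in> young_diagram \<mu>" using a later[of k 1] by (auto simp: numeral_2_eq_2)
    then have "(k, 1) \<in> young_diagram \<mu>"
      using young_diagram_downward[OF p, of k 2 k 1] m by auto
    then show False using col[of k] m by auto
  qed
  ultimately show "?\<nu> \<in> near_staircase k"
    using shift(1) by (simp add: near_staircase_def)
  assume s: "s \<le> 2 * k"
  then show "s \<in> extremal k ?\<nu> \<longleftrightarrow> (s + 2) mod (2 * k + 1) \<in> extremal k \<mu>"
  proof (cases rule: free_box_cases)
    case (even q)
    show ?thesis
    proof (cases "q = k")
      case True
      have L: "s \<in> extremal k ?\<nu> \<longleftrightarrow> length \<mu> + 1 \<le> k"
        using first[of "k + 1"] even True by (auto simp: extremal_def)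
      show ?thesis
      \<comment> \<open>For \<open>k = 0\<close> there is no index \<open>1\<close>; the only
        residue is \<open>0\<close>.\<close>
      proof (cases "k = 0")
        case True
        have "(1, 1) \<notin> young_diagram \<mu>" using \<mu> True by (auto simp: near_staircase_def)
        then show ?thesis unfolding L using True by (auto simp: extremal_def free_box_def)
      next
        case False
        then have "(s + 2) mod (2 * k + 1) = Suc (2 * 0)"
          using even(1) \<open>q = k\<close> by (simp add: mod_if)
        then show ?thesis
          unfolding L using False free_box_odd[of k 0] col[of k] by (auto simp: extremal_def)
      qed
    next
      case False
      then have m: "(s + 2) mod (2 * k + 1) = 2 * (q + 1)" using even by simp
      have "free_box k s = (k - q + 1, q + 1)" using even by auto
      then show ?thesis
        unfolding m using even False later[of "k - q" "q + 1"] free_box_even[of k "q + 1"]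
        by (auto simp: extremal_def)
    qed
  next
    case (odd q)
    show ?thesis
    proof (cases "q + 1 = k")
      case True
      have L: "s \<in> extremal k ?\<nu> \<longleftrightarrow> k < length \<mu>"
        using first[of k] odd True by (auto simp: extremal_def)
      have "s + 2 = 2 * k + 1" using odd True by simp
      then have "(s + 2) mod (2 * k + 1) = 2 * 0" by simp
      then show ?thesis
        unfolding L using free_box_even[of k 0] col[of "k + 1"] by (auto simp: extremal_def)
    next
      case False
      then have m: "(s + 2) mod (2 * k + 1) = Suc (2 * (q + 1))" using odd by simp
      have "free_box k s = (k - (q + 1) + 1, q + 1)" using odd by auto
      then show ?thesis
        unfolding m using odd False later[of "k - (q + 1)" "q + 1"] free_box_odd[of k "q + 1"]
        by (auto simp: extremal_def)
    qed
  qed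
qed

section \<open>Sizes of partitions between the staircases\<close>

lemma card_staircase: "real (card (staircase k)) = real k * (real k - 1) / 2"
proof (induction k)
  case 0
  have "staircase 0 = {}" by (auto simp: staircase_def)
  then show ?case by simp
next
  case (Suc k)
  have fin: "finite (staircase k)"
    by (rule finite_subset[of _ "{..k} \<times> {..k}"]) (auto simp: staircase_def)
  have "staircase (Suc k) = staircase k \<union> (\<lambda>r. (r, Suc k - r)) ` {1..k}"
    by (force simp: staircase_def)
  moreover have "staircase k \<inter> (\<lambda>r. (r, Suc k - r)) ` {1..k} = {}"
    by (auto simp: staircase_def)
  moreover have "card ((\<lambda>r. (r, Suc k - r)) ` {1..k}) = k"
    by (subst card_image) (auto simp: inj_on_def)
  ultimately have "card (staircase (Suc k)) = card (staircase k) + k"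
    using fin by (simp add: card_Un_disjoint)
  then show ?case using Suc by (simp add: field_simps)
qed

text \<open>Beyond the staircase the size counts the free boxes present. An even index contributes
  \<open>1\<close> if extremal, an odd one \<open>1\<close> if not, whence the constant
  \<open>k\<close> and the alternating sign. The result has the shape of the inversion formula for
  edge sums.\<close>

lemma sum_list_near_staircase:
  assumes "\<mu> \<in> near_staircase k"
  shows "real (sum_list \<mu>) - real k * (real k - 1) / 2 =
    real k + (\<Sum>s<2 * k + 1. (- 1) ^ s * of_bool (s \<in> extremal k \<mu>))"
proof -
  let ?W = "{s. s \<le> 2 * k \<and> (s \<in> extremal k \<mu> \<longleftrightarrow> even s)}"
  have W: "?W \<subseteq> {..2 * k}" by auto
  have "staircase k \<inter> free_box k ` ?W = {}"
    using free_box_in_staircase(2) by blast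
  moreover have "finite (staircase k)"
    by (rule finite_subset[of _ "{..k} \<times> {..k}"]) (auto simp: staircase_def)
  moreover have "card (free_box k ` ?W) = card ?W"
    by (rule card_image[OF inj_on_subset[OF inj_on_free_box W]])
  ultimately have "card (young_diagram \<mu>) = card (staircase k) + card ?W"
    unfolding near_staircase_diagram[OF assms] by (subst card_Un_disjoint) auto
  then have "real (sum_list \<mu>) - real k * (real k - 1) / 2 = real (card ?W)"
    by (simp add: card_young_diagram card_staircase)
  also have "real (card ?W) = (\<Sum>s<2 * k + 1. of_bool (s \<in> ?W))"
  proof -
    have "real (card ?W) = (\<Sum>s\<in>?W. 1)" by simp
    also have "\<dots> = (\<Sum>s<2 * k + 1. of_bool (s \<in> ?W))"
      by (rule sum.mono_neutral_cong_left) auto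
    finally show ?thesis .
  qed
  also have "\<dots> = (\<Sum>s<2 * k + 1. of_bool (odd s) + (- 1) ^ s * of_bool (s \<in> extremal k \<mu>))"
    by (rule sum.cong) auto
  also have "\<dots> = (\<Sum>s<2 * k + 1. of_bool (odd s)) +
      (\<Sum>s<2 * k + 1. (- 1) ^ s * of_bool (s \<in> extremal k \<mu>))"
    by (rule sum.distrib)
  also have "(\<Sum>s<2 * k + 1. of_bool (odd s)) = real k"
    by (induction k) auto
  finally show ?thesis .
qed

section \<open>The injective hull of an odd cycle\<close>

locale odd_cycle_metric =
  fixes k N :: nat and \<alpha> :: "nat \<Rightarrow> 'n::finite" and d :: "'n \<Rightarrow> 'n \<Rightarrow> real"
  assumes N_eq: "N = 2 * k + 1" and odd_cycle: "odd_cycle k \<alpha> d"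
begin

section \<open>The metric in the ordering of the cycle by maximal steps\<close>

lemma alpha_bij: "bij_betw \<alpha> {..<N} UNIV"
  and alpha_N: "\<alpha> N = \<alpha> 0"
  using odd_cycle by (auto simp: odd_cycle_def N_eq Let_def)

text \<open>The formula does not change when an index \<open>0\<close> is replaced by
  \<open>N\<close>, so it extends to the index \<open>N\<close>.\<close>

lemma dist_alpha:
  assumes "i \<le> N" "j \<le> N"
  shows "d (\<alpha> i) (\<alpha> j) = 2 * min \<bar>real j - real i\<bar> (real N - \<bar>real j - real i\<bar>)"
proof -
  have *: "d (\<alpha> i) (\<alpha> j) = 2 * min \<bar>real j - real i\<bar> (real N - \<bar>real j - real i\<bar>)"
    if "i < N" "j < N" for i j
    using odd_cycle that by (auto simp: odd_cycle_def N_eq Let_def)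
  have "N > 0" by (simp add: N_eq)
  then show ?thesis
    using *[of i j] *[of 0 j] *[of i 0] *[of 0 0] assms alpha_N
    by (cases "i = N"; cases "j = N") (auto simp: min_def)
qed

text \<open>Consecutive points \<open>\<beta> s\<close>, \<open>\<beta> (s + 1)\<close> are at maximal distance \<open>2 * k\<close>: as \<open>k + 1\<close> is the
  inverse of \<open>2\<close> modulo \<open>N\<close>, the point \<open>\<beta> s\<close> is \<open>\<alpha>\<close> at \<open>s / 2\<close>.\<close>

definition \<beta> :: "nat \<Rightarrow> 'n" where
  "\<beta> s = \<alpha> (((k + 1) * s) mod N)"

lemma N_pos: "N > 0" and odd_N: "odd N" and real_N: "real N = 2 * real k + 1"
  by (simp_all add: N_eq)

lemma beta_eq_iff: "\<beta> s = \<beta> t \<longleftrightarrow> s mod N = t mod N"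
proof
  have half: "(2 * (((k + 1) * s) mod N)) mod N = s mod N" for s
  proof -
    have "2 * ((k + 1) * s) = s + s * N" by (simp add: N_eq algebra_simps)
    then show ?thesis by (metis mod_mult_right_eq mod_mult_self1)
  qed
  assume "\<beta> s = \<beta> t"
  then have "((k + 1) * s) mod N = ((k + 1) * t) mod N"
    using alpha_bij N_pos unfolding \<beta>_def bij_betw_def inj_on_def by auto
  then show "s mod N = t mod N" using half by metis
next
  assume "s mod N = t mod N"
  then show "\<beta> s = \<beta> t" unfolding \<beta>_def by (metis mod_mult_right_eq)
qed

lemma beta_add_N [simp]: "\<beta> (s + N) = \<beta> s"
  by (simp add: beta_eq_iff)

lemma alpha_eq_beta:
  assumes "i \<le> N"
  shows "\<alpha> i = \<beta> (2 * i)"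
proof -
  have "((k + 1) * (2 * i)) mod N = (i + i * N) mod N" by (simp add: N_eq algebra_simps)
  also have "\<dots> = i mod N" by simp
  finally show ?thesis
    using alpha_N assms by (cases "i = N") (auto simp: \<beta>_def)
qed

lemma beta_surj: "\<exists>s<N. x = \<beta> s"
proof -
  obtain i where i: "i < N" "x = \<alpha> i"
    using alpha_bij by (auto simp: bij_betw_def)
  then have "x = \<beta> ((2 * i) mod N)" using alpha_eq_beta[of i] by (simp add: beta_eq_iff)
  then show ?thesis using N_pos by (metis mod_less_divisor)
qed

lemma beta_bij: "bij_betw \<beta> {..<N} UNIV"
  using beta_surj by (auto simp: bij_betw_def inj_on_def beta_eq_iff)

lemma beta_Suc_surj: "\<exists>s. x = \<beta> (Suc s)"
proof -
  obtain s where "x = \<beta> s" using beta_surj by blast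
  then have "x = \<beta> (Suc (s + 2 * k))" using beta_add_N[of s] by (simp add: N_eq)
  then show ?thesis by blast
qed

text \<open>Brings an arbitrary pair of points into the form to which \<open>dist_beta\<close>
  applies.\<close>

lemma beta_pair: "\<exists>s m. m < N \<and> x = \<beta> s \<and> y = \<beta> (s + m)"
proof -
  obtain s t where st: "s < N" "x = \<beta> s" "t < N" "y = \<beta> t" using beta_surj by metis
  show ?thesis
  proof (cases "s \<le> t")
    case True
    then show ?thesis using st by (intro exI[of _ s] exI[of _ "t - s"]) auto
  next
    case False
    then show ?thesis
      using st beta_add_N[of t] by (intro exI[of _ s] exI[of _ "t + N - s"]) auto
  qed
qed

lemma dist_alpha_offset:
  assumes "a < N" "e \<le> N"
  shows "d (\<alpha> a) (\<alpha> ((a + e) mod N)) = 2 * min (real e) (real N - real e)"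
proof (cases "a + e < N")
  case True
  then show ?thesis using assms dist_alpha[of a "a + e"] by simp
next
  case False
  then have "(a + e) mod N = a + e - N" using assms by (simp add: mod_if)
  then show ?thesis
    using False assms dist_alpha[of a "a + e - N"] by (auto simp: of_nat_diff min_def)
qed

text \<open>An even \<open>m = 2 * q\<close> is an offset of \<open>q\<close> along
  \<open>\<alpha>\<close>. An odd \<open>m = 2 * q + 1\<close> is an offset of
  \<open>q + k + 1\<close>, where the shorter way round has \<open>k - q\<close> steps.\<close>

lemma dist_beta:
  assumes "m \<le> N"
  shows "d (\<beta> s) (\<beta> (s + m)) = (if even m then real m else real N - real m)"
proof -
  let ?a = "((k + 1) * s) mod N"
  have shift: "\<beta> (s + m) = \<alpha> ((?a + e) mod N)" if "((k + 1) * m) mod N = e mod N" for e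
  proof -
    have "((k + 1) * (s + m)) mod N = ((k + 1) * s + (k + 1) * m) mod N"
      by (simp add: algebra_simps)
    also have "\<dots> = (?a + e) mod N"
      using that by (metis mod_add_eq mod_mod_trivial)
    finally show ?thesis by (simp add: \<beta>_def)
  qed
  show ?thesis
  proof (cases "even m")
    case True
    then obtain q where q: "m = 2 * q" by (auto elim: evenE)
    have "(k + 1) * m = q + q * N" by (simp add: q N_eq algebra_simps)
    then have "((k + 1) * m) mod N = q mod N" by simp
    then have e: "\<beta> (s + m) = \<alpha> ((?a + q) mod N)" by (rule shift)
    have "q \<le> N" using assms q by simp
    then have "d (\<beta> s) (\<beta> (s + m)) = 2 * min (real q) (real N - real q)"
      unfolding e using dist_alpha_offset[of ?a q] N_pos by (simp add: \<beta>_def)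
    then show ?thesis using q assms by simp
  next
    case False
    then obtain q where q: "m = 2 * q + 1" by (auto elim: oddE)
    have "(k + 1) * m = (q + k + 1) + q * N" by (simp add: q N_eq algebra_simps)
    then have "((k + 1) * m) mod N = (q + k + 1) mod N" by (simp only: mod_mult_self1)
    then have e: "\<beta> (s + m) = \<alpha> ((?a + (q + k + 1)) mod N)" by (rule shift)
    have "q + k + 1 \<le> N" using assms q by (simp add: N_eq)
    then have "d (\<beta> s) (\<beta> (s + m)) = 2 * min (real (q + k + 1)) (real N - real (q + k + 1))"
      unfolding e using dist_alpha_offset[of ?a "q + k + 1"] N_pos by (simp add: \<beta>_def)
    then show ?thesis using q assms by (simp add: real_N)
  qed
qed

lemma dist_sym: "d x y = d y x"
proof -
  obtain i j where "i < N" "x = \<alpha> i" "j < N" "y = \<alpha> j"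
    using alpha_bij unfolding bij_betw_def by (metis UNIV_I image_iff lessThan_iff)
  then show ?thesis using dist_alpha[of i j] dist_alpha[of j i] by (simp add: abs_minus_commute)
qed

lemma dist_beta_Suc: "d (\<beta> s) (\<beta> (Suc s)) = 2 * real k"
  using dist_beta[of 1 s] N_pos by (simp add: N_eq)

text \<open>For \<open>N > 1\<close> the points \<open>\<beta> s\<close> and
  \<open>\<beta> (s + 2)\<close> are neighbours on the cycle, at distance \<open>2\<close>; this is
  the triangle inequality for them, read off from the distance formula.\<close>

lemma dist_two_steps: "\<bar>d (\<beta> s) w - d (\<beta> (s + 2)) w\<bar> \<le> 2"
proof -
  obtain t m where tm: "m < N" "\<beta> s = \<beta> t" "w = \<beta> (t + m)" using beta_pair by metis
  have st: "\<beta> (s + 2) = \<beta> (t + 2)" using tm(2) unfolding beta_eq_iff by (metis mod_add_left_eq)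
  have d1: "d (\<beta> s) w = (if even m then real m else real N - real m)"
    unfolding tm(2,3) by (rule dist_beta) (use tm in simp)
  consider "m = 0" | "m = 1" | "2 \<le> m" by linarith
  then show ?thesis
  proof cases
    case 1
    then have w: "w = \<beta> t" using tm by simp
    show ?thesis
    \<comment> \<open>For \<open>N = 1\<close> two steps lie beyond the range of
      \<open>dist_beta\<close>, but all points coincide.\<close>
    proof (cases "N = 1")
      case True
      then have "\<beta> (t + 2) = \<beta> t" unfolding beta_eq_iff by simp
      then show ?thesis unfolding w st tm(2) by simp
    next
      case False
      then have "2 \<le> N" using N_pos by simp
      then show ?thesis
        using d1 1 dist_beta[of 2 t] dist_sym[of "\<beta> (t + 2)" "\<beta> t"] unfolding w st tm(2) by simp
    qed
  next
    case 2
    then have "w = \<beta> (Suc t)" using tm by simp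
    then show ?thesis
      using d1 2 dist_beta_Suc[of "Suc t"] dist_sym[of "\<beta> (t + 2)" w] unfolding st tm(2)
      by (simp add: real_N)
  next
    case 3
    then obtain n where n: "m = n + 2" by (metis add.commute le_Suc_ex)
    have "w = \<beta> (t + 2 + n)" using tm(3) n by (simp add: algebra_simps)
    then have "d (\<beta> (s + 2)) w = (if even n then real n else real N - real n)"
      using dist_beta[of n "t + 2"] tm n unfolding st by simp
    then show ?thesis unfolding d1 n by simp
  qed
qed

section \<open>Edge sums as coordinates\<close>

definition nxt :: "'n \<Rightarrow> 'n" where
  "nxt x = \<beta> (Suc (SOME s. \<beta> s = x))"

lemma nxt_beta [simp]: "nxt (\<beta> s) = \<beta> (Suc s)"
proof -
  have "\<beta> (SOME t. \<beta> t = \<beta> s) = \<beta> s" by (rule someI) simp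
  \<comment> \<open>The chosen representative does not matter, since \<open>\<beta> (Suc s)\<close>
    depends only on \<open>s\<close> modulo \<open>N\<close>.\<close>
  then show ?thesis unfolding nxt_def beta_eq_iff by (metis mod_Suc_eq)
qed

lemma all_beta: "(\<forall>x. P x) \<longleftrightarrow> (\<forall>s. P (\<beta> s))"
  using beta_surj by metis

text \<open>Each edge is indexed by its starting point, so that \<open>edge\<close> is an
  endomorphism of the space of functions on the cycle.\<close>

definition edge :: "real ^ 'n \<Rightarrow> real ^ 'n" where
  "edge g = (\<chi> x. g $ x + g $ nxt x)"

lemma edge_beta: "edge g $ \<beta> s = g $ \<beta> s + g $ \<beta> (Suc s)"
  by (simp add: edge_def)

lemma linear_edge: "linear edge"
  by (rule linearI) (auto simp: edge_def vec_eq_iff algebra_simps)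

text \<open>The alternating sum telescopes. After the odd number \<open>N\<close> of steps it
  returns to the starting point with sign \<open>- 1\<close>, so the two boundary terms add up
  instead of cancelling.\<close>

lemma edge_alternating_sum:
  "2 * g $ \<beta> s = (\<Sum>l<N. (- 1) ^ l * edge g $ \<beta> (s + l))"
proof -
  have "(\<Sum>l<m. (- 1) ^ l * edge g $ \<beta> (s + l)) = g $ \<beta> s - (- 1) ^ m * g $ \<beta> (s + m)" for m
    by (induction m) (auto simp: edge_beta algebra_simps)
  from this[of N] show ?thesis using odd_N by simp
qed

lemma inj_edge: "inj edge"
proof (rule injI)
  fix g h assume "edge g = edge h"
  then have "g $ \<beta> s = h $ \<beta> s" for s
    using edge_alternating_sum[of g s] edge_alternating_sum[of h s] by simp
  then show "g = h" unfolding vec_eq_iff all_beta by blast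
qed

lemma bij_edge: "bij edge"
  using linear_injective_imp_surjective[OF linear_edge inj_edge] inj_edge by (simp add: bij_def)

section \<open>The injective hull in terms of edge sums\<close>

lemma hull_polyhedron_edge:
  assumes "g \<in> hull_polyhedron d"
  shows "2 * real k \<le> edge g $ x"
proof -
  obtain s where s: "x = \<beta> s" using beta_surj by blast
  have "d (\<beta> s) (\<beta> (Suc s)) \<le> g $ \<beta> s + g $ \<beta> (Suc s)"
    using assms by (simp add: hull_polyhedron_def)
  then show ?thesis unfolding s edge_beta dist_beta_Suc .
qed

lemma two_step_iterate:
  assumes "\<And>s. \<bar>g $ \<beta> s - g $ \<beta> (s + 2)\<bar> \<le> 2"
  shows "\<bar>g $ \<beta> s - g $ \<beta> (s + 2 * q)\<bar> \<le> 2 * real q"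
proof (induction q)
  case (Suc q)
  have "\<bar>g $ \<beta> (s + 2 * q) - g $ \<beta> (s + 2 * Suc q)\<bar> \<le> 2"
    using assms[of "s + 2 * q"] by (simp add: algebra_simps)
  with Suc show ?case by simp
qed simp

text \<open>From left to right, double steps carry a tight partner of a point to one of its two
  neighbours, at a cost that the distance formula compensates exactly; that edge then has the
  minimal sum \<open>2 * k\<close>. From right to left, double steps carry the bound
  \<open>2 * k\<close> from edges to arbitrary pairs, and an edge of sum \<open>2 * k\<close> at
  each point supplies a tight partner.\<close>

lemma injective_hull_iff:
  "g \<in> injective_hull d \<longleftrightarrow>
    (\<forall>x. 2 * real k \<le> edge g $ x \<and> edge g $ x \<le> 2 * real k + 2 \<and>
      (edge g $ x = 2 * real k \<or> edge g $ nxt x = 2 * real k))"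
proof
  assume g: "g \<in> injective_hull d"
  then have poly: "g \<in> hull_polyhedron d" and
    tight: "\<exists>y. g $ x + g $ y = d x y" and ge: "g $ x + g $ y \<ge> d x y" for x y
    by (auto simp: injective_hull_def hull_polyhedron_def)
  \<comment> \<open>Each point is tight with some partner; comparing that partner with the other
    point bounds the difference by a difference of distances.\<close>
  have two: "\<bar>g $ \<beta> s - g $ \<beta> (s + 2)\<bar> \<le> 2" for s
  proof -
    obtain w where w: "g $ \<beta> s + g $ w = d (\<beta> s) w" using tight by blast
    obtain w' where w': "g $ \<beta> (s + 2) + g $ w' = d (\<beta> (s + 2)) w'" using tight by blast
    show ?thesis
      using w w' ge[of "\<beta> s" w'] ge[of "\<beta> (s + 2)" w] dist_two_steps[of s w] dist_two_steps[of s w']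
      by linarith
  qed
  note far = two_step_iterate[OF two]
  have zero: "edge g $ \<beta> s = 2 * real k \<or> edge g $ \<beta> (Suc s) = 2 * real k" for s
  proof -
    obtain y where y: "g $ \<beta> (Suc s) + g $ y = d (\<beta> (Suc s)) y" using tight by blast
    obtain t m where tm: "m < N" "\<beta> (Suc s) = \<beta> t" "y = \<beta> (t + m)" using beta_pair by metis
    have sum: "g $ \<beta> t + g $ \<beta> (t + m) = (if even m then real m else real N - real m)"
      using y dist_beta[of m t] tm by simp
    show ?thesis
    proof (cases "even m")
      case False
      then obtain q where q: "m = 2 * q + 1" by (auto elim: oddE)
      have "\<bar>g $ \<beta> (Suc t) - g $ \<beta> (t + m)\<bar> \<le> 2 * real q"
        using far[of "Suc t" q] by (simp add: q)
      then have "edge g $ \<beta> t \<le> 2 * real k"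
        using sum False unfolding edge_beta by (simp add: q real_N)
      then show ?thesis using hull_polyhedron_edge[OF poly, of "\<beta> t"] tm(2) by simp
    next
      case True
      then obtain q where q: "m = 2 * q" by (auto elim: evenE)
      have qk: "q \<le> k" using tm q by (simp add: N_eq)
      \<comment> \<open>As \<open>2 * k = N - 1\<close>, the point
        \<open>\<beta> (t + 2 * k)\<close> is the predecessor \<open>\<beta> s\<close>; it is
        reached from the tight partner in \<open>k - q\<close> double steps.\<close>
      have "t mod N = Suc s mod N" using tm(2) by (simp add: beta_eq_iff)
      then have "(t + 2 * k) mod N = (Suc s + 2 * k) mod N" by (metis mod_add_left_eq)
      then have "\<beta> (t + 2 * k) = \<beta> (s + N)" unfolding beta_eq_iff by (simp add: N_eq)
      then have ts: "\<beta> (t + 2 * k) = \<beta> s" by simp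
      have "t + m + 2 * (k - q) = t + 2 * k" using q qk by simp
      then have "\<bar>g $ \<beta> (t + m) - g $ \<beta> (t + 2 * k)\<bar> \<le> 2 * real (k - q)"
        using far[of "t + m" "k - q"] by (simp only:)
      then have "edge g $ \<beta> s \<le> 2 * real k"
        using sum True qk unfolding edge_beta tm(2) ts by (simp add: q of_nat_diff)
      then show ?thesis using hull_polyhedron_edge[OF poly, of "\<beta> s"] by simp
    qed
  qed
  have "edge g $ \<beta> s \<le> 2 * real k + 2" for s
    using zero[of s] two[of s] by (auto simp: edge_beta)
  then show "\<forall>x. 2 * real k \<le> edge g $ x \<and> edge g $ x \<le> 2 * real k + 2 \<and>
      (edge g $ x = 2 * real k \<or> edge g $ nxt x = 2 * real k)"
    unfolding all_beta using zero hull_polyhedron_edge[OF poly] by simp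
next
  assume a: "\<forall>x. 2 * real k \<le> edge g $ x \<and> edge g $ x \<le> 2 * real k + 2 \<and>
      (edge g $ x = 2 * real k \<or> edge g $ nxt x = 2 * real k)"
  have lower: "2 * real k \<le> g $ \<beta> s + g $ \<beta> (Suc s)"
    and zero: "edge g $ \<beta> s = 2 * real k \<or> edge g $ \<beta> (Suc s) = 2 * real k" for s
    using a[rule_format, of "\<beta> s"] by (auto simp: edge_beta)
  \<comment> \<open>This is the difference of two consecutive edge sums, both in an interval of
    length \<open>2\<close>.\<close>
  have "\<bar>g $ \<beta> s - g $ \<beta> (s + 2)\<bar> \<le> 2" for s
    using a[rule_format, of "\<beta> s"] a[rule_format, of "\<beta> (Suc s)"] by (auto simp: edge_beta)
  note far = two_step_iterate[OF this]
  have "d x y \<le> g $ x + g $ y" for x y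
  proof -
    obtain s m where sm: "m < N" "x = \<beta> s" "y = \<beta> (s + m)" using beta_pair by metis
    have dist: "d x y = (if even m then real m else real N - real m)"
      using sm dist_beta[of m s] by simp
    show ?thesis
    proof (cases "even m")
      case False
      then obtain q where q: "m = 2 * q + 1" by (auto elim: oddE)
      then show ?thesis
        using far[of "Suc s" q] lower[of s] dist False sm by (simp add: real_N)
    next
      case True
      then obtain q where q: "m = 2 * q" by (auto elim: evenE)
      have qk: "q \<le> k" using sm q by (simp add: N_eq)
      have "s + m + 2 * (k - q) = s + 2 * k" using q qk by simp
      then have "\<bar>g $ \<beta> (s + m) - g $ \<beta> (s + 2 * k)\<bar> \<le> 2 * real (k - q)"
        using far[of "s + m" "k - q"] by (simp only:)
      moreover have "Suc (s + 2 * k) = s + N" by (simp add: N_eq)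
      then have "\<beta> (Suc (s + 2 * k)) = \<beta> s" by (simp only: beta_add_N)
      ultimately show ?thesis
        using lower[of "s + 2 * k"] dist True sm qk by (simp add: q of_nat_diff)
    qed
  qed
  moreover have "\<exists>y. g $ x + g $ y = d x y" for x
  proof -
    obtain s where x: "x = \<beta> (Suc s)" using beta_Suc_surj by blast
    have "d x (\<beta> s) = 2 * real k" "d x (\<beta> (Suc (Suc s))) = 2 * real k"
      unfolding x using dist_beta_Suc dist_sym by metis+
    moreover have "g $ x + g $ \<beta> s = 2 * real k \<or> g $ x + g $ \<beta> (Suc (Suc s)) = 2 * real k"
      using zero[of s] by (auto simp: x edge_beta)
    ultimately show ?thesis by metis
  qed
  ultimately show "g \<in> injective_hull d" by (auto simp: injective_hull_def hull_polyhedron_def)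
qed

end

section \<open>Faces of the injective hull\<close>

text \<open>The box is the image of the unit cube under scaling and translation. Sides of length
  zero are allowed, since faces of all dimensions are treated as such boxes.\<close>

lemma cbox_corner_hull:
  fixes a b :: "real ^ 'n"
  assumes "\<And>i. a $ i \<le> b $ i"
  shows "cbox a b = convex hull {x. \<forall>i. x $ i = a $ i \<or> x $ i = b $ i}"
proof
  let ?V = "{x. \<forall>i. x $ i = a $ i \<or> x $ i = b $ i}"
  let ?f = "\<lambda>x :: real ^ 'n. \<chi> i. (b $ i - a $ i) * x $ i"
  have lin: "linear ?f" by (rule linearI) (auto simp: vec_eq_iff algebra_simps)
  show "convex hull ?V \<subseteq> cbox a b"
  proof (rule hull_minimal)
    show "?V \<subseteq> cbox a b"
    proof
      fix x assume x: "x \<in> ?V"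
      have "a $ i \<le> x $ i \<and> x $ i \<le> b $ i" for i
        using x[unfolded mem_Collect_eq, rule_format, of i] assms[of i] by auto
      then show "x \<in> cbox a b" by (simp add: mem_box_cart)
    qed
  qed (rule convex_box)
  show "cbox a b \<subseteq> convex hull ?V"
  proof
    fix x assume x: "x \<in> cbox a b"
    \<comment> \<open>On a side of length zero the quotient is \<open>0\<close> by the convention
      for division by zero, which still lies in the unit interval.\<close>
    define y where "y = (\<chi> i. (x $ i - a $ i) / (b $ i - a $ i))"
    have "0 \<le> y $ i \<and> y $ i \<le> 1" for i
      using x assms[of i] by (auto simp: y_def mem_box_cart divide_le_eq_1 divide_nonneg_nonneg)
    then have "y \<in> cbox 0 (\<Sum>Basis)"
      unfolding Cart_1[symmetric] by (simp add: mem_box_cart)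
    moreover have "{x :: real ^ 'n. \<forall>i\<in>Basis. x \<bullet> i = 0 \<or> x \<bullet> i = 1} =
        {x. \<forall>i. x $ i = 0 \<or> x $ i = 1}"
      by (simp add: Basis_vec_def inner_axis)
    ultimately have "y \<in> convex hull {x. \<forall>i. x $ i = 0 \<or> x $ i = 1}"
      by (simp add: unit_interval_convex_hull)
    then have "?f y \<in> convex hull (?f ` {x. \<forall>i. x $ i = 0 \<or> x $ i = 1})"
      unfolding convex_hull_linear_image[OF lin, symmetric] by blast
    then have "a + ?f y \<in> convex hull ((+) a ` ?f ` {x. \<forall>i. x $ i = 0 \<or> x $ i = 1})"
      unfolding convex_hull_translation by blast
    moreover have "(+) a ` ?f ` {x. \<forall>i. x $ i = 0 \<or> x $ i = 1} \<subseteq> ?V"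
    proof -
      have "(a + ?f x) $ i = a $ i \<or> (a + ?f x) $ i = b $ i" if "\<forall>i. x $ i = 0 \<or> x $ i = 1" for x i
        using that[rule_format, of i] by auto
      then show ?thesis by blast
    qed
    ultimately have "a + ?f y \<in> convex hull ?V"
      using hull_mono by blast
    moreover have "a + ?f y = x"
      unfolding vec_eq_iff
    proof
      fix i
      have "a $ i \<le> x $ i" "x $ i \<le> b $ i" using x by (auto simp: mem_box_cart)
      then show "(a + ?f y) $ i = x $ i"
        by (cases "b $ i = a $ i") (auto simp: y_def)
    qed
    ultimately show "x \<in> convex hull ?V" by simp
  qed
qed

text \<open>Translated to the origin, the box spans the coordinate subspace of its sides of positive
  length.\<close>

lemma aff_dim_cbox_cart:
  fixes a b :: "real ^ 'n"
  assumes le: "\<And>i. a $ i \<le> b $ i"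
  shows "aff_dim (cbox a b) = int (card {i. a $ i < b $ i})"
proof -
  let ?J = "{i. a $ i < b $ i}"
  let ?D = "(\<lambda>i. axis i 1 :: real ^ 'n) ` ?J"
  have "aff_dim (cbox a b) = aff_dim ((+) (- a) ` cbox a b)"
    by (rule aff_dim_translation_eq[symmetric])
  also have "(+) (- a) ` cbox a b = cbox 0 (b - a)"
    using cbox_translation[of "- a" a b] by simp
  also have "aff_dim (cbox 0 (b - a)) = int (dim (cbox 0 (b - a)))"
    by (rule aff_dim_zero, rule hull_inc) (use le in \<open>auto simp: mem_box_cart\<close>)
  also have "dim (cbox 0 (b - a)) = dim {x :: real ^ 'n. \<forall>i\<in>Basis. i \<notin> ?D \<longrightarrow> x \<bullet> i = 0}"
  proof (rule antisym)
    show "dim (cbox 0 (b - a)) \<le> dim {x :: real ^ 'n. \<forall>i\<in>Basis. i \<notin> ?D \<longrightarrow> x \<bullet> i = 0}"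
    proof (rule dim_subset, rule subsetI, intro CollectI ballI impI)
      fix x i :: "real ^ 'n"
      assume x: "x \<in> cbox 0 (b - a)" and "i \<in> Basis" "i \<notin> ?D"
      then obtain j where j: "i = axis j 1" "\<not> a $ j < b $ j"
        by (auto simp: Basis_vec_def)
      then have "a $ j = b $ j" using le[of j] by simp
      moreover have "0 \<le> x $ j \<and> x $ j \<le> b $ j - a $ j" using x by (auto simp: mem_box_cart)
      ultimately show "x \<bullet> i = 0" by (simp add: j inner_axis)
    qed
    have sp: "?D \<subseteq> span (cbox 0 (b - a))"
    proof
      fix i assume "i \<in> ?D"
      then obtain j where j: "i = axis j 1" "a $ j < b $ j" by auto
      have "(b $ j - a $ j) *\<^sub>R i \<in> cbox 0 (b - a)"
        using j le by (auto simp: mem_box_cart axis_def)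
      then have "(1 / (b $ j - a $ j)) *\<^sub>R ((b $ j - a $ j) *\<^sub>R i) \<in> span (cbox 0 (b - a))"
        by (intro span_scale span_base)
      then show "i \<in> span (cbox 0 (b - a))" using j by simp
    qed
    show "dim {x :: real ^ 'n. \<forall>i\<in>Basis. i \<notin> ?D \<longrightarrow> x \<bullet> i = 0} \<le> dim (cbox 0 (b - a))"
    proof -
      have "{x :: real ^ 'n. \<forall>i\<in>Basis. i \<notin> ?D \<longrightarrow> x \<bullet> i = 0} \<subseteq> span ?D"
        by (subst span_substd_basis) (auto simp: Basis_vec_def)
      also have "\<dots> \<subseteq> span (cbox 0 (b - a))" by (rule span_minimal[OF sp]) simp
      finally have "dim {x :: real ^ 'n. \<forall>i\<in>Basis. i \<notin> ?D \<longrightarrow> x \<bullet> i = 0} \<le>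
          dim (span (cbox 0 (b - a)))"
        by (rule dim_subset)
      then show ?thesis by (simp only: dim_span)
    qed
  qed
  also have "\<dots> = card ?D" by (rule dim_substandard) (auto simp: Basis_vec_def)
  also have "card ?D = card ?J" by (rule card_image) (auto simp: inj_on_def axis_eq_axis)
  finally show ?thesis .
qed

lemma finite_positive_lower_bound:
  fixes f :: "'a \<Rightarrow> real"
  assumes "finite A" "\<And>x. x \<in> A \<Longrightarrow> 0 < f x"
  obtains \<delta> where "0 < \<delta>" "\<And>x. x \<in> A \<Longrightarrow> \<delta> \<le> f x"
proof
  \<comment> \<open>The inserted \<open>1\<close> covers the case of an empty set.\<close>
  show "0 < Min (insert 1 (f ` A))" using assms by auto
  show "Min (insert 1 (f ` A)) \<le> f x" if "x \<in> A" for x using assms(1) that by auto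
qed

section \<open>Cubes in edge coordinates\<close>

context odd_cycle_metric
begin

definition independent_set :: "'n set \<Rightarrow> bool" where
  "independent_set S \<longleftrightarrow> (\<forall>x\<in>S. nxt x \<notin> S)"

definition corner :: "'n set \<Rightarrow> real ^ 'n" where
  "corner S = (\<chi> x. 2 * real k + 2 * of_bool (x \<in> S))"

definition hull_vertex :: "'n set \<Rightarrow> real ^ 'n" where
  "hull_vertex S = inv edge (corner S)"

text \<open>For \<open>S' \<subseteq> S\<close> the edge sums are \<open>2 * k + 2\<close> on
  \<open>S'\<close> and \<open>2 * k\<close> outside \<open>S\<close>, and vary over the whole
  interval on \<open>S - S'\<close>.\<close>

definition hull_cube :: "'n set \<Rightarrow> 'n set \<Rightarrow> (real ^ 'n) set" where
  "hull_cube S' S = edge -` cbox (corner S') (corner S)"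

lemma edge_hull_vertex: "edge (hull_vertex S) = corner S"
  unfolding hull_vertex_def using bij_edge by (simp add: bij_is_surj surj_f_inv_f)

lemma hull_vertex_unique: "edge g = corner S \<longleftrightarrow> g = hull_vertex S"
  using edge_hull_vertex inj_edge by (metis injD)

lemma corner_nth: "corner S $ x = 2 * real k + 2 * of_bool (x \<in> S)"
  by (simp add: corner_def)

lemma inj_corner: "corner S = corner T \<longleftrightarrow> S = T"
  by (auto simp: vec_eq_iff corner_nth split: if_splits)

lemma inj_hull_vertex: "hull_vertex S = hull_vertex T \<longleftrightarrow> S = T"
  using edge_hull_vertex inj_corner by metis

lemma corner_mono: "S' \<subseteq> S \<Longrightarrow> corner S' $ x \<le> corner S $ x"
  by (auto simp: corner_nth)

lemma edge_hull_cube: "edge ` hull_cube S' S = cbox (corner S') (corner S)"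
  unfolding hull_cube_def using bij_edge by (simp add: bij_is_surj surj_image_vimage_eq)

lemma hull_cube_eq_convex_hull:
  assumes "S' \<subseteq> S"
  shows "hull_cube S' S = convex hull (hull_vertex ` {T. S' \<subseteq> T \<and> T \<subseteq> S})"
proof -
  have "{x. \<forall>i. x $ i = corner S' $ i \<or> x $ i = corner S $ i} = corner ` {T. S' \<subseteq> T \<and> T \<subseteq> S}"
  proof (intro equalityI subsetI)
    fix x assume x: "x \<in> {x. \<forall>i. x $ i = corner S' $ i \<or> x $ i = corner S $ i}"
    \<comment> \<open>The subset is recovered as the set of coordinates with the upper
      value.\<close>
    have "x = corner {i. x $ i = 2 * real k + 2}"
      unfolding vec_eq_iff
    proof
      fix i
      show "x $ i = corner {i. x $ i = 2 * real k + 2} $ i"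
        using x[unfolded mem_Collect_eq, rule_format, of i] by (auto simp: corner_nth split: if_splits)
    qed
    moreover have "S' \<subseteq> {i. x $ i = 2 * real k + 2}"
    proof
      fix i assume "i \<in> S'"
      then show "i \<in> {i. x $ i = 2 * real k + 2}"
        using x[unfolded mem_Collect_eq, rule_format, of i] assms by (auto simp: corner_nth)
    qed
    moreover have "{i. x $ i = 2 * real k + 2} \<subseteq> S"
    proof
      fix i assume "i \<in> {i. x $ i = 2 * real k + 2}"
      then show "i \<in> S"
        using x[unfolded mem_Collect_eq, rule_format, of i] assms by (auto simp: corner_nth split: if_splits)
    qed
    ultimately show "x \<in> corner ` {T. S' \<subseteq> T \<and> T \<subseteq> S}" by blast
  next
    fix x assume "x \<in> corner ` {T. S' \<subseteq> T \<and> T \<subseteq> S}"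
    then show "x \<in> {x. \<forall>i. x $ i = corner S' $ i \<or> x $ i = corner S $ i}"
      by (auto simp: corner_nth)
  qed
  then have "edge ` hull_cube S' S = convex hull (corner ` {T. S' \<subseteq> T \<and> T \<subseteq> S})"
    unfolding edge_hull_cube using cbox_corner_hull[OF corner_mono[OF assms]] by simp
  also have "corner ` {T. S' \<subseteq> T \<and> T \<subseteq> S} = edge ` hull_vertex ` {T. S' \<subseteq> T \<and> T \<subseteq> S}"
    by (simp add: image_image edge_hull_vertex)
  also have "convex hull \<dots> = edge ` (convex hull (hull_vertex ` {T. S' \<subseteq> T \<and> T \<subseteq> S}))"
    by (rule convex_hull_linear_image[OF linear_edge, symmetric])
  finally show ?thesis using inj_edge by (simp add: inj_image_eq_iff)
qed

lemma aff_dim_hull_cube: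
  assumes "S' \<subseteq> S"
  shows "aff_dim (hull_cube S' S) = int (card (S - S'))"
proof -
  have "aff_dim (hull_cube S' S) = aff_dim (edge ` hull_cube S' S)"
    using aff_dim_injective_linear_image[OF linear_edge inj_edge] by simp
  also have "\<dots> = int (card {i. corner S' $ i < corner S $ i})"
    unfolding edge_hull_cube by (rule aff_dim_cbox_cart[OF corner_mono[OF assms]])
  also have "{i. corner S' $ i < corner S $ i} = S - S'"
    using assms by (auto simp: corner_nth split: if_splits)
  finally show ?thesis .
qed

lemma mem_hull_cube:
  "g \<in> hull_cube S' S \<longleftrightarrow> (\<forall>x. corner S' $ x \<le> edge g $ x \<and> edge g $ x \<le> corner S $ x)"
  by (auto simp: hull_cube_def mem_box_cart)

lemma hull_cube_subset_injective_hull: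
  assumes "independent_set S"
  shows "hull_cube S' S \<subseteq> injective_hull d"
proof
  fix g assume g: "g \<in> hull_cube S' S"
  have le: "2 * real k \<le> edge g $ x" "edge g $ x \<le> 2 * real k + 2 * of_bool (x \<in> S)" for x
    using g[unfolded mem_hull_cube, rule_format, of x] by (auto simp: corner_nth of_bool_def split: if_splits)
  have "edge g $ x = 2 * real k \<or> edge g $ nxt x = 2 * real k" for x
    using le[of x] le[of "nxt x"] assms by (auto simp: independent_set_def of_bool_def split: if_splits)
  moreover have "edge g $ x \<le> 2 * real k + 2" for x
    using le[of x] by (auto simp: of_bool_def split: if_splits)
  ultimately show "g \<in> injective_hull d"
    unfolding injective_hull_iff using le by blast
qed

text \<open>The inequality of two points three steps apart, at distance \<open>2 * k - 2\<close>. It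
  bounds an edge sum from above by \<open>2 * k + 2\<close> as soon as both neighbouring edges have
  sum \<open>2 * k\<close>.\<close>

lemma hull_polyhedron_three_edges:
  assumes "g \<in> hull_polyhedron d" "3 \<le> N"
  shows "edge g $ \<beta> (Suc s) \<le> edge g $ \<beta> s + edge g $ \<beta> (Suc (Suc s)) - 2 * real k + 2"
proof -
  have "d (\<beta> s) (\<beta> (s + 3)) \<le> g $ \<beta> s + g $ \<beta> (s + 3)"
    using assms by (simp add: hull_polyhedron_def)
  moreover have "d (\<beta> s) (\<beta> (s + 3)) = 2 * real k - 2"
    using dist_beta[of 3 s] assms by (simp add: real_N)
  ultimately show ?thesis by (simp add: edge_beta numeral_3_eq_3)
qed

lemma edge_convex_combination:
  "edge ((1 - u) *\<^sub>R a + u *\<^sub>R b) $ x = (1 - u) * edge a $ x + u * edge b $ x"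
  by (simp add: edge_def algebra_simps)

text \<open>For \<open>N = 1\<close> the only edge is a loop, so a nonempty independent set forces
  three points.\<close>

lemma independent_set_N: "independent_set S \<Longrightarrow> x \<in> S \<Longrightarrow> 3 \<le> N"
proof (rule ccontr)
  assume S: "independent_set S" "x \<in> S" "\<not> 3 \<le> N"
  then have "N = 1" using N_eq by auto
  moreover obtain s where "x = \<beta> s" using beta_surj by blast
  moreover have "\<beta> (Suc s) = \<beta> s" unfolding beta_eq_iff using \<open>N = 1\<close> by simp
  ultimately have "nxt x = x" by (metis nxt_beta)
  then show False using S by (auto simp: independent_set_def)
qed

text \<open>For a segment meeting the cube in its interior, equality in the lower bound passes to
  both endpoints outside \<open>S\<close>. The inequality for three edges then yields the upper
  bound on \<open>S\<close>, and equality in it on \<open>S'\<close> passes to the endpoints as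
  well.\<close>

lemma hull_cube_face_of:
  assumes ind: "independent_set S" and sub: "S' \<subseteq> S"
  shows "hull_cube S' S face_of hull_polyhedron d"
  unfolding face_of_def
proof (intro conjI ballI impI)
  show "hull_cube S' S \<subseteq> hull_polyhedron d"
    using hull_cube_subset_injective_hull[OF ind] by (auto simp: injective_hull_def)
  show "convex (hull_cube S' S)"
    unfolding hull_cube_eq_convex_hull[OF sub] by (rule convex_convex_hull)
next
  fix a b x
  assume ab: "a \<in> hull_polyhedron d" "b \<in> hull_polyhedron d" and x: "x \<in> hull_cube S' S"
    and "x \<in> open_segment a b"
  then obtain u where u: "0 < u" "u < 1" "x = (1 - u) *\<^sub>R a + u *\<^sub>R b"
    by (auto simp: in_segment)
  have e: "edge x $ i = (1 - u) * edge a $ i + u * edge b $ i" for i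
    unfolding u(3) by (rule edge_convex_combination)
  \<comment> \<open>A one-sided bound on both endpoints that is attained by a proper convex
    combination is attained by both.\<close>
  have mix: "p = c \<and> q = c" if "c = (1 - u) * p + u * q" "c \<le> p \<and> c \<le> q \<or> p \<le> c \<and> q \<le> c" for p q c
  proof -
    have z: "(1 - u) * (p - c) + u * (q - c) = 0" using that(1) by (simp add: algebra_simps)
    have "p - c = 0 \<and> q - c = 0"
    proof (cases "c \<le> p \<and> c \<le> q")
      case True
      then have "0 \<le> (1 - u) * (p - c)" "0 \<le> u * (q - c)" using u by auto
      then have "(1 - u) * (p - c) = 0" "u * (q - c) = 0" using z by linarith+
      then show ?thesis using u by auto
    next
      case False
      then have "p \<le> c" "q \<le> c" using that(2) by auto
      then have "(1 - u) * (p - c) \<le> 0" "u * (q - c) \<le> 0" using u by (auto intro: mult_nonneg_nonpos)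
      then have "(1 - u) * (p - c) = 0" "u * (q - c) = 0" using z by linarith+
      then show ?thesis using u by auto
    qed
    then show ?thesis by simp
  qed
  note lower = hull_polyhedron_edge[OF ab(1)] hull_polyhedron_edge[OF ab(2)]
  have xS: "corner S' $ i \<le> edge x $ i" "edge x $ i \<le> corner S $ i" for i
    using x by (auto simp: mem_hull_cube)
  have outside: "edge a $ i = 2 * real k \<and> edge b $ i = 2 * real k" if "i \<notin> S" for i
  proof -
    have "edge x $ i = 2 * real k"
      using xS[of i] that subsetD[OF sub, of i] by (cases "i \<in> S'") (auto simp: corner_nth)
    then show ?thesis using mix[OF e[of i]] lower[of i] by simp
  qed
  have inside: "edge a $ i \<le> 2 * real k + 2 \<and> edge b $ i \<le> 2 * real k + 2" if "i \<in> S" for i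
  proof -
    obtain s where s: "i = \<beta> (Suc s)" using beta_Suc_surj by blast
    have "\<beta> s \<notin> S" "\<beta> (Suc (Suc s)) \<notin> S"
      using ind that unfolding s independent_set_def by (metis nxt_beta)+
    then show ?thesis
      using hull_polyhedron_three_edges[OF ab(1) independent_set_N[OF ind that], of s]
        hull_polyhedron_three_edges[OF ab(2) independent_set_N[OF ind that], of s] outside
      unfolding s by simp
  qed
  have full: "edge a $ i = 2 * real k + 2 \<and> edge b $ i = 2 * real k + 2" if "i \<in> S'" for i
  proof -
    have "edge x $ i = 2 * real k + 2"
      using xS[of i] that subsetD[OF sub, of i] by (simp add: corner_nth)
    then show ?thesis using mix[OF e[of i]] inside[of i] that sub by auto
  qed
  show "a \<in> hull_cube S' S" "b \<in> hull_cube S' S"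
    unfolding mem_hull_cube corner_nth using outside inside full lower sub
    by (auto simp: of_bool_def)
qed

text \<open>The edge sums of a relative interior point \<open>z\<close> of the face determine the
  cube. Conversely every point of the cube lies on a segment within the cube that passes through
  \<open>z\<close>, and a face through \<open>z\<close> contains the endpoints of such a
  segment.\<close>

lemma face_eq_hull_cube:
  assumes F: "F face_of hull_polyhedron d" "F \<subseteq> injective_hull d" "F \<noteq> {}"
  shows "\<exists>S S'. independent_set S \<and> S' \<subseteq> S \<and> F = hull_cube S' S"
proof -
  have "convex F" using F(1) by (simp add: face_of_def)
  then obtain z where z: "z \<in> rel_interior F"
    using F(3) rel_interior_eq_empty by blast
  then have zF: "z \<in> F" using rel_interior_subset by blast
  define S where "S = {x. edge z $ x \<noteq> 2 * real k}"
  define S' where "S' = {x. edge z $ x = 2 * real k + 2}"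
  have zE: "2 * real k \<le> edge z $ x" "edge z $ x \<le> 2 * real k + 2"
    "edge z $ x = 2 * real k \<or> edge z $ nxt x = 2 * real k" for x
    using zF F(2) injective_hull_iff[of z] by auto
  have ind: "independent_set S" using zE(3) by (auto simp: independent_set_def S_def)
  have sub: "S' \<subseteq> S" by (auto simp: S_def S'_def)
  have zc: "z \<in> hull_cube S' S"
    unfolding mem_hull_cube corner_nth using zE by (auto simp: S_def S'_def of_bool_def)
  \<comment> \<open>The cube is itself a face and contains a relative interior point of
    \<open>F\<close>, hence all of \<open>F\<close>.\<close>
  have "F \<subseteq> hull_cube S' S"
    using subset_of_face_of[OF hull_cube_face_of[OF ind sub], of F] z zc F(1)
    by (auto simp: face_of_def)
  moreover have "hull_cube S' S \<subseteq> F"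
  proof
    fix w assume w: "w \<in> hull_cube S' S"
    show "w \<in> F"
    proof (cases "w = z")
      case True
      then show ?thesis using zF by simp
    next
      case False
      obtain \<delta> where \<delta>: "0 < \<delta>" and
        \<delta>_le: "\<And>x. x \<in> S - S' \<Longrightarrow> \<delta> \<le> min (edge z $ x - 2 * real k) (2 * real k + 2 - edge z $ x)"
        by (rule finite_positive_lower_bound[of "S - S'"
            "\<lambda>x. min (edge z $ x - 2 * real k) (2 * real k + 2 - edge z $ x)"])
          (use zE(1,2) in \<open>auto simp: S_def S'_def less_le\<close>)
      \<comment> \<open>Edge sums within the cube differ by at most \<open>2\<close>, so half the
        margin \<open>\<delta>\<close> keeps the point \<open>w'\<close> beyond \<open>z\<close>, on
        the line from \<open>w\<close>, inside the cube.\<close>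
      define \<epsilon> where "\<epsilon> = \<delta> / 2"
      define w' where "w' = (1 - (- \<epsilon>)) *\<^sub>R z + (- \<epsilon>) *\<^sub>R w"
      have e: "edge w' $ x = edge z $ x + \<epsilon> * (edge z $ x - edge w $ x)" for x
        unfolding w'_def edge_convex_combination by (simp add: algebra_simps)
      have wS: "corner S' $ x \<le> edge w $ x" "edge w $ x \<le> corner S $ x" for x
        using w by (auto simp: mem_hull_cube)
      have zS: "corner S' $ x \<le> edge z $ x" "edge z $ x \<le> corner S $ x" for x
        using zc by (auto simp: mem_hull_cube)
      have "corner S' $ x \<le> edge w' $ x \<and> edge w' $ x \<le> corner S $ x" for x
      proof (cases "x \<in> S - S'")
        case True
        have b: "\<bar>edge z $ x - edge w $ x\<bar> \<le> 2"
          using wS[of x] zS[of x] True by (simp add: corner_nth)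
        have "\<bar>\<epsilon> * (edge z $ x - edge w $ x)\<bar> \<le> \<delta>"
        proof -
          have "\<epsilon> * \<bar>edge z $ x - edge w $ x\<bar> \<le> \<epsilon> * 2"
            using b \<delta> by (intro mult_left_mono) (auto simp: \<epsilon>_def)
          then show ?thesis using \<delta> by (simp add: abs_mult \<epsilon>_def)
        qed
        then show ?thesis using \<delta>_le[OF True] True unfolding e by (auto simp: corner_nth)
      next
        case False
        then have "corner S' $ x = corner S $ x" using sub by (auto simp: corner_nth)
        then have "edge z $ x = corner S $ x" "edge w $ x = corner S $ x"
          using wS[of x] zS[of x] by auto
        then show ?thesis using \<open>corner S' $ x = corner S $ x\<close> unfolding e by simp
      qed
      then have w': "w' \<in> hull_cube S' S" by (simp add: mem_hull_cube)
      have \<epsilon>: "0 < \<epsilon>" using \<delta> by (simp add: \<epsilon>_def)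
      have "z = (1 - \<epsilon> / (1 + \<epsilon>)) *\<^sub>R w' + (\<epsilon> / (1 + \<epsilon>)) *\<^sub>R w"
      proof -
        have "(1 + \<epsilon>) *\<^sub>R ((1 - \<epsilon> / (1 + \<epsilon>)) *\<^sub>R w' + (\<epsilon> / (1 + \<epsilon>)) *\<^sub>R w) = w' + \<epsilon> *\<^sub>R w"
          using \<epsilon> by (simp add: scaleR_add_right divide_simps)
        also have "\<dots> = (1 + \<epsilon>) *\<^sub>R z" by (simp add: w'_def)
        finally show ?thesis using \<epsilon> by (simp add: scaleR_cancel_left)
      qed
      moreover have "w' \<noteq> w"
      proof
        assume "w' = w"
        then have "(1 + \<epsilon>) *\<^sub>R (z - w) = 0" by (simp add: w'_def algebra_simps)
        then show False using False \<epsilon> by simp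
      qed
      ultimately have "z \<in> open_segment w' w"
        unfolding in_segment using \<epsilon> by (intro conjI exI[of _ "\<epsilon> / (1 + \<epsilon>)"]) (auto simp: divide_simps)
      moreover have "w \<in> hull_polyhedron d" "w' \<in> hull_polyhedron d"
        using w w' hull_cube_face_of[OF ind sub] by (auto simp: face_of_def)
      ultimately show ?thesis using F(1) zF unfolding face_of_def by blast
    qed
  qed
  ultimately show ?thesis using ind sub by blast
qed

lemma hull_face_iff:
  "hull_face d v F \<longleftrightarrow>
    (\<exists>S S'. independent_set S \<and> S' \<subseteq> S \<and> card (S - S') = v \<and>
      F = convex hull (hull_vertex ` {T. S' \<subseteq> T \<and> T \<subseteq> S}))"
proof
  assume F: "hull_face d v F"
  then have "F \<noteq> {}" by (auto simp: hull_face_def)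
  then obtain S S' where S: "independent_set S" "S' \<subseteq> S" "F = hull_cube S' S"
    using F face_eq_hull_cube[of F] unfolding hull_face_def by blast
  then have "card (S - S') = v"
    using F aff_dim_hull_cube[OF S(2)] by (simp add: hull_face_def)
  then show "\<exists>S S'. independent_set S \<and> S' \<subseteq> S \<and> card (S - S') = v \<and>
      F = convex hull (hull_vertex ` {T. S' \<subseteq> T \<and> T \<subseteq> S})"
    using S hull_cube_eq_convex_hull[OF S(2)] by blast
next
  assume "\<exists>S S'. independent_set S \<and> S' \<subseteq> S \<and> card (S - S') = v \<and>
      F = convex hull (hull_vertex ` {T. S' \<subseteq> T \<and> T \<subseteq> S})"
  then obtain S S' where S: "independent_set S" "S' \<subseteq> S" "card (S - S') = v" "F = hull_cube S' S"
    using hull_cube_eq_convex_hull by metis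
  show "hull_face d v F"
    unfolding hull_face_def S(4)
    using hull_cube_face_of[OF S(1,2)] hull_cube_subset_injective_hull[OF S(1)]
      aff_dim_hull_cube[OF S(2)] S(3) by blast
qed

lemma hull_vertices_eq: "hull_vertices d = hull_vertex ` {S. independent_set S}"
proof -
  have single: "{T. S' \<subseteq> T \<and> T \<subseteq> S} = {S}" if "S' \<subseteq> S" "card (S - S') = 0" for S S' :: "'n set"
    using that by auto
  show ?thesis
  proof (intro equalityI subsetI)
    fix g assume "g \<in> hull_vertices d"
    then obtain S S' where S: "independent_set S" "S' \<subseteq> S" "card (S - S') = 0"
        "{g} = convex hull (hull_vertex ` {T. S' \<subseteq> T \<and> T \<subseteq> S})"
      unfolding hull_vertices_def hull_face_iff by auto
    then show "g \<in> hull_vertex ` {S. independent_set S}"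
      using single[OF S(2,3)] by auto
  next
    fix g assume "g \<in> hull_vertex ` {S. independent_set S}"
    then obtain S where "independent_set S" "g = hull_vertex S" by blast
    then show "g \<in> hull_vertices d"
      unfolding hull_vertices_def hull_face_iff
      by (intro CollectI exI[of _ S]) (auto simp: single)
  qed
qed

end

section \<open>Outer rims\<close>

lemma site_refl: "p \<in> site N p"
  by (simp add: site_def)

lemma site_eq_iff: "site N p = site N q \<longleftrightarrow> q \<in> site N p"
proof
  assume "q \<in> site N p"
  then have "equivclp (moebius_glue N) p q" by (simp add: site_def)
  then show "site N p = site N q"
    unfolding site_def by (intro Collect_cong iffI) (blast intro: equivclp_sym equivclp_trans)+
qed (use site_refl in blast)

lemma site_glue:
  assumes "i \<le> N"
  shows "site N (i, N) = site N (0, i)"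
proof -
  have "moebius_glue N (i, N) (0, i)" using assms by (simp add: moebius_glue_def)
  then have "(0, i) \<in> site N (i, N)" unfolding site_def by (auto intro: r_into_equivclp)
  then show ?thesis by (simp only: site_eq_iff)
qed

text \<open>Gluing changes \<open>i + j\<close> by \<open>N\<close>, so this residue labels the
  diagonals of the strip independently of the position.\<close>

lemma site_sum_mod:
  assumes "(i, j) \<in> site N (i', j')"
  shows "(i + j) mod N = (i' + j') mod N"
  using site_well_defined[of "\<lambda>i. i mod N" N "\<lambda>x y. (x + y) mod N", OF _ _ assms]
  by (simp add: add.commute mod_simps)

lemma ball_site:
  assumes "\<alpha> N = \<alpha> 0" "\<And>x y. P x y = P y x"
  shows "(\<forall>(i', j') \<in> site N (i, j). P (\<alpha> i') (\<alpha> j')) \<longleftrightarrow> P (\<alpha> i) (\<alpha> j)"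
  using site_well_defined[where f = P, OF assms] site_refl[of "(i, j)" N] by blast

text \<open>The rim before passing to sites; its positions in the row \<open>j = N\<close> are glued
  to positions \<open>(0, i)\<close>.\<close>

definition rim_positions :: "nat \<Rightarrow> nat list \<Rightarrow> (nat \<times> nat) set" where
  "rim_positions N \<mu> = {(i, j). row_len \<mu> 1 \<le> j \<and> j \<le> N \<and>
     row_len_ext N \<mu> (N + 1 - j) \<le> i \<and> i \<le> row_len_ext N \<mu> (N - j)}"

lemma outer_rim_eq: "outer_rim N \<mu> = site N ` rim_positions N \<mu>"
  by (simp add: outer_rim_def rim_positions_def)

section \<open>Positions along the outer rim\<close>

lemma rim_positions_iff:
  "(i, j) \<in> rim_positions N \<mu> \<longleftrightarrow> row_len \<mu> 1 \<le> j \<and> j \<le> N \<and> row_len \<mu> (N + 1 - j) \<le> i \<and>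
    (if j = N then i \<le> N - length \<mu> else i \<le> row_len \<mu> (N - j))"
  by (auto simp: rim_positions_def row_len_ext_def)

lemma rim_positions_le:
  assumes \<mu>: "is_partition \<mu>" and p: "(i, j) \<in> rim_positions N \<mu>"
  shows "i \<le> j" "j \<le> N"
proof -
  show "j \<le> N" using p by (simp add: rim_positions_iff)
  show "i \<le> j"
  proof (cases "j = N")
    case False
    moreover have "j \<le> N" using p by (simp add: rim_positions_iff)
    ultimately have "1 \<le> N - j" by linarith
    then show ?thesis
      using p False row_len_antimono[OF \<mu>, of 1 "N - j"] by (simp add: rim_positions_iff)
  next
    case True
    then have "i \<le> N - length \<mu>" using p by (simp add: rim_positions_iff)
    then show ?thesis using True by linarith
  qed
qed

text \<open>At a rim position the box \<open>(N + 1 - j, i + 1)\<close> is absent, and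
  \<open>(N - j, i)\<close> is present when \<open>j < N\<close> and \<open>1 \<le> i\<close>. The
  staircases leave four values of \<open>j - i\<close>. For the two larger ones the absent box is
  the free box of the diagonal, for the two smaller ones the present box. At \<open>i = 0\<close> or
  \<open>j = N\<close> in the latter cases, the length of the first row or column shows instead that
  the free box reached by wrapping around is absent.\<close>

lemma rim_positions_near_staircase:
  assumes \<mu>: "\<mu> \<in> near_staircase k" and N: "N = 2 * k + 1" and p: "(i, j) \<in> rim_positions N \<mu>"
  shows "(j = i + k \<or> j = i + k + 1) \<and> (i + j + k) mod N \<notin> extremal k \<mu> \<or>
    (j + 1 = i + k \<or> j = i + k + 2) \<and> (i + j + k) mod N \<in> extremal k \<mu>"
proof -
  have part: "is_partition \<mu>" and
    st: "1 \<le> r \<Longrightarrow> 1 \<le> c \<Longrightarrow> r + c \<le> k \<Longrightarrow> (r, c) \<in> young_diagram \<mu>" and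
    st': "(r, c) \<in> young_diagram \<mu> \<Longrightarrow> r + c \<le> k + 2" for r c
    using \<mu> by (auto simp: near_staircase_def staircase_def)
  note len = near_staircase_lengths[OF \<mu>]
  have ij: "i \<le> j" "j \<le> N" using rim_positions_le[OF part p] by auto
  have out: "(N + 1 - j, i + 1) \<notin> young_diagram \<mu>"
    and first: "row_len \<mu> 1 \<le> j" and last: "j = N \<Longrightarrow> i + length \<mu> \<le> N"
    using p len N by (auto simp: rim_positions_iff in_young_diagram)
  have inside: "(N - j, i) \<in> young_diagram \<mu>" if "j < N" "1 \<le> i"
    using p that by (auto simp: rim_positions_iff in_young_diagram)
  have "j \<le> i + k + 2" using st[of "N + 1 - j" "i + 1"] out ij N by fastforce
  moreover have "i + k \<le> j + 1"
  proof -
    consider "j = N" | "i = 0" | "j < N" "1 \<le> i" using ij by linarith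
    then show ?thesis
    proof cases
      case 1
      then show ?thesis using last len N by auto
    next
      case 2
      then show ?thesis using first len by auto
    next
      case 3
      then show ?thesis using st'[OF inside[OF 3]] N by linarith
    qed
  qed
  ultimately consider "j = i + k + 2" | "j = i + k + 1" | "j = i + k" | "j + 1 = i + k" by linarith
  then show ?thesis
  proof cases
    case 1
    then have e: "i + j + k = Suc (2 * i) + N" "i < k" using ij N by auto
    then have m: "(i + j + k) mod N = Suc (2 * i)" "i < k"
      unfolding e(1) mod_add_self2 using N by auto
    have "N + 1 - j = k - i" using 1 N by simp
    then have "free_box k (Suc (2 * i)) \<notin> young_diagram \<mu>"
      using out by (simp add: free_box_odd)
    then have "(i + j + k) mod N \<in> extremal k \<mu>" unfolding m using m by (simp add: extremal_def)
    then show ?thesis using 1 by simp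
  next
    case 2
    then have e: "i + j + k = 2 * i + N" "i \<le> k" using ij N by auto
    then have m: "(i + j + k) mod N = 2 * i" "i \<le> k"
      unfolding e(1) mod_add_self2 using N by auto
    have "N + 1 - j = k + 1 - i" using 2 N by simp
    then have "free_box k (2 * i) \<notin> young_diagram \<mu>"
      using out by (simp add: free_box_even)
    then have "(i + j + k) mod N \<notin> extremal k \<mu>" unfolding m using m by (simp add: extremal_def)
    then show ?thesis using 2 by simp
  next
    case 3
    have "(i + j + k) mod N \<notin> extremal k \<mu>"
    proof -
      consider "i = 0" | "j = N" "1 \<le> i" | "j < N" "1 \<le> i" using ij by linarith
      then show ?thesis
      proof cases
        case 1
        then have m: "(i + j + k) mod N = 2 * k" using 3 N by simp
        have "free_box k (2 * k) \<notin> young_diagram \<mu>"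
          using first 1 3 in_first_row[of "k + 1" \<mu>] by (auto simp: free_box_even)
        then show ?thesis unfolding m by (simp add: extremal_def)
      next
        case 2
        then have i: "i = k + 1" using 3 N by simp
        have "i + j + k = 2 * N" using 2 i N by simp
        then have m: "(i + j + k) mod N = 2 * 0" by simp
        have "free_box k (2 * 0) \<notin> young_diagram \<mu>"
          unfolding free_box_even using last 2 i N in_first_column[OF part, of "k + 1"] by auto
        then show ?thesis unfolding m by (simp add: extremal_def)
      next
        case sub: 3
        have e: "i + j + k = Suc (2 * (i - 1)) + N" "Suc (2 * (i - 1)) < N" using sub 3 N by auto
        then have m: "(i + j + k) mod N = Suc (2 * (i - 1))" unfolding e(1) mod_add_self2 by simp
        have "free_box k (Suc (2 * (i - 1))) = (N - j, i)"
          unfolding free_box_odd using sub 3 N by auto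
        then show ?thesis unfolding m using inside[OF sub] by (simp add: extremal_def)
      qed
    qed
    then show ?thesis using 3 by simp
  next
    case 4
    have "(i + j + k) mod N \<in> extremal k \<mu>"
    proof -
      have k1: "1 \<le> k" using 4 ij by linarith
      consider "i = 0" | "j = N" "1 \<le> i" | "j < N" "1 \<le> i" using ij by linarith
      then show ?thesis
      proof cases
        case 1
        then have "i + j + k = Suc (2 * (k - 1))" using 4 k1 by simp
        then have m: "(i + j + k) mod N = Suc (2 * (k - 1))" using N k1 by simp
        have "(1, k) \<notin> young_diagram \<mu>"
          using first 1 4 k1 in_first_row[of k \<mu>] by auto
        then have "free_box k (Suc (2 * (k - 1))) \<notin> young_diagram \<mu>"
          unfolding free_box_odd using k1 by simp
        then show ?thesis unfolding m using k1 by (simp add: extremal_def)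
      next
        case 2
        then have i: "i = k + 2" using 4 N by simp
        have "i + j + k = Suc (2 * 0) + 2 * N" using 2 i N by simp
        then have "(i + j + k) mod N = Suc (2 * 0) mod N" by (simp only: mod_mult_self1 mod_mult_self2)
        then have m: "(i + j + k) mod N = Suc (2 * 0)" using k1 N by simp
        have "free_box k (Suc (2 * 0)) \<notin> young_diagram \<mu>"
          unfolding free_box_odd using last 2 i N in_first_column[OF part, of k] by auto
        then show ?thesis unfolding m using k1 by (simp add: extremal_def)
      next
        case sub: 3
        have e: "i + j + k = 2 * (i - 1) + N" "2 * (i - 1) < N" using sub 4 N by auto
        then have m: "(i + j + k) mod N = 2 * (i - 1)" unfolding e(1) mod_add_self2 by simp
        have "free_box k (2 * (i - 1)) = (N - j, i)"
          unfolding free_box_even using sub 4 N by auto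
        then show ?thesis unfolding m using inside[OF sub] e N by (simp add: extremal_def)
      qed
    qed
    then show ?thesis using 4 by simp
  qed
qed

text \<open>If the free box of the diagonal is absent, its own position
  \<open>(c - 1, N + 1 - r)\<close> is on the rim; if it is present, the position
  \<open>(c, N - r)\<close> is, which has the same coordinate sum.\<close>

lemma rim_positions_surj:
  assumes \<mu>: "\<mu> \<in> near_staircase k" and N: "N = 2 * k + 1" and s: "s < N"
  shows "\<exists>i j. (i, j) \<in> rim_positions N \<mu> \<and> (i + j + k) mod N = s"
proof -
  have part: "is_partition \<mu>" and
    st: "1 \<le> r \<Longrightarrow> 1 \<le> c \<Longrightarrow> r + c \<le> k \<Longrightarrow> (r, c) \<in> young_diagram \<mu>" and
    st': "(r, c) \<in> young_diagram \<mu> \<Longrightarrow> r + c \<le> k + 2" for r c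
    using \<mu> by (auto simp: near_staircase_def staircase_def)
  note len = near_staircase_lengths[OF \<mu>]
  have free: "(c - 1, N + 1 - r) \<in> rim_positions N \<mu>"
    if "(r, c) \<notin> young_diagram \<mu>" "1 \<le> r" "1 \<le> c" "r + c \<le> k + 2" for r c
  proof -
    have "row_len \<mu> 1 \<le> N + 1 - r" using len that N by auto
    moreover have "N + 1 - (N + 1 - r) = r" using that N by simp
    moreover have "row_len \<mu> r \<le> c - 1" using that by (auto simp: in_young_diagram)
    moreover have "c - 1 \<le> N - length \<mu>" using that N len by auto
    moreover have "c - 1 \<le> row_len \<mu> (N - (N + 1 - r))" if "r \<noteq> 1"
    proof (cases "c = 1")
      case False
      then have "(r - 1, c - 1) \<in> young_diagram \<mu>"
        using st[of "r - 1" "c - 1"] \<open>r \<noteq> 1\<close> \<open>1 \<le> r\<close> \<open>1 \<le> c\<close> \<open>r + c \<le> k + 2\<close> by auto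
      moreover have "N - (N + 1 - r) = r - 1" using \<open>r + c \<le> k + 2\<close> \<open>1 \<le> r\<close> N by auto
      ultimately show ?thesis by (simp add: in_young_diagram)
    qed simp
    ultimately show ?thesis using that(2) by (auto simp: rim_positions_iff)
  qed
  have filled: "(c, N - r) \<in> rim_positions N \<mu>"
    if rc: "(r, c) \<in> young_diagram \<mu>" "k + 1 \<le> r + c" for r c
  proof -
    have b: "1 \<le> r" "1 \<le> c" "c \<le> row_len \<mu> r" "r + c \<le> k + 2"
      using rc st' by (auto simp: in_young_diagram)
    then have "r \<le> length \<mu>" using row_len_pos_iff[OF part, of r] by auto
    then have "row_len \<mu> 1 \<le> N - r" using len N by linarith
    moreover have "row_len \<mu> (r + 1) \<le> c"
    proof (rule ccontr)
      assume "\<not> ?thesis"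
      then have "(r + 1, c + 1) \<in> young_diagram \<mu>" by (simp add: in_young_diagram)
      then show False using st' rc(2) by fastforce
    qed
    moreover have "N + 1 - (N - r) = r + 1" "N - (N - r) = r" "N - r \<noteq> N" using b N by auto
    ultimately show ?thesis using b by (simp add: rim_positions_iff)
  qed
  have "s \<le> 2 * k" using s N by simp
  then show ?thesis
  proof (cases rule: free_box_cases)
    case (even q)
    show ?thesis
    proof (cases "(k + 1 - q, q + 1) \<in> young_diagram \<mu>")
      case True
      have "q + 1 + (N - (k + 1 - q)) + k = s + N" using even N by simp
      moreover have "(q + 1, N - (k + 1 - q)) \<in> rim_positions N \<mu>"
        using even by (intro filled[OF True]) auto
      ultimately show ?thesis using s by (metis mod_add_self2 mod_less)
    next
      case False
      have "q + 1 - 1 + (N + 1 - (k + 1 - q)) + k = s + N" using even N by simp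
      moreover have "(q + 1 - 1, N + 1 - (k + 1 - q)) \<in> rim_positions N \<mu>"
        using even by (intro free[OF False]) auto
      ultimately show ?thesis using s by (metis mod_add_self2 mod_less)
    qed
  next
    case (odd q)
    show ?thesis
    proof (cases "(k - q, q + 1) \<in> young_diagram \<mu>")
      case True
      have "q + 1 + (N - (k - q)) + k = s + N" using odd N by simp
      moreover have "(q + 1, N - (k - q)) \<in> rim_positions N \<mu>"
        using odd by (intro filled[OF True]) auto
      ultimately show ?thesis using s by (metis mod_add_self2 mod_less)
    next
      case False
      have "q + 1 - 1 + (N + 1 - (k - q)) + k = s + N" using odd N by simp
      moreover have "(q + 1 - 1, N + 1 - (k - q)) \<in> rim_positions N \<mu>"
        using odd by (intro free[OF False]) auto
      ultimately show ?thesis using s by (metis mod_add_self2 mod_less)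
    qed
  qed
qed

text \<open>The label \<open>(i + j + k) mod N\<close> maps the sites of the rim bijectively onto
  the residues.\<close>

lemma card_outer_rim:
  assumes \<mu>: "\<mu> \<in> near_staircase k" and N: "N = 2 * k + 1"
  shows "card (outer_rim N \<mu>) = N"
proof -
  have part: "is_partition \<mu>" using \<mu> by (simp add: near_staircase_def)
  note len = near_staircase_lengths[OF \<mu>]
  \<comment> \<open>Representatives with \<open>j < N\<close>. A position \<open>(i, N)\<close> is
    glued to \<open>(0, i)\<close>, which is in \<open>R\<close> unless \<open>i = N\<close>; then
    the partition is empty and \<open>(0, 0)\<close> serves.\<close>
  define R where "R = {(i, j) \<in> rim_positions N \<mu>. j < N}"
  have rep: "\<exists>q \<in> R. site N q = site N p" if "p \<in> rim_positions N \<mu>" for p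
  proof -
    obtain i j where p: "p = (i, j)" by (cases p)
    show ?thesis
    proof (cases "j = N")
      case False
      then have "p \<in> R" using that rim_positions_le[OF part, of i j N] by (simp add: R_def p)
      then show ?thesis by blast
    next
      case True
      then have i: "row_len \<mu> 1 \<le> i" "i + length \<mu> \<le> N"
        using that len N by (auto simp: p rim_positions_iff)
      have short: "row_len \<mu> (N + 1 - j) = 0" if "length \<mu> + j \<le> N" for j
      proof -
        have "\<not> N + 1 - j \<le> length \<mu>" using that by linarith
        then show ?thesis by (simp add: row_len_def)
      qed
      have "site N p = site N (0, i)" using site_glue[of i N] True i by (simp add: p)
      show ?thesis
      proof (cases "i = N")
        case False
        then have "(0, i) \<in> R"
          using i short[of i] by (auto simp: R_def rim_positions_iff add.commute)
        then show ?thesis using \<open>site N p = site N (0, i)\<close> by metis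
      next
        case True
        then have "\<mu> = []" using i by simp
        then have "(0, 0) \<in> R" using N by (auto simp: R_def rim_positions_iff row_len_def)
        moreover have "site N (0, i) = site N (0, 0)" using True site_glue[of 0 N] by simp
        ultimately show ?thesis using \<open>site N p = site N (0, i)\<close> by metis
      qed
    qed
  qed
  let ?h = "\<lambda>(i, j). (i + j + k) mod N"
  have h_site: "?h p = ?h q" if "site N p = site N q" for p q
  proof -
    obtain i j i' j' where pq: "p = (i, j)" "q = (i', j')" by (cases p; cases q)
    have "(i + j) mod N = (i' + j') mod N"
      using that site_sum_mod[of i j N i' j'] unfolding pq by (metis site_eq_iff)
    then have "(i + j + k) mod N = (i' + j' + k) mod N" by (rule mod_add_cong) simp
    then show ?thesis by (simp add: pq)
  qed
  have inj: "inj_on ?h R"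
  proof (rule inj_onI)
    fix p q assume p: "p \<in> R" and q: "q \<in> R" and h: "?h p = ?h q"
    obtain i j i' j' where pq: "p = (i, j)" "q = (i', j')" by (cases p; cases q)
    have b: "row_len \<mu> 1 \<le> j" "j < N" "row_len \<mu> (N + 1 - j) \<le> i" "i \<le> row_len \<mu> (N - j)"
      "row_len \<mu> 1 \<le> j'" "j' < N" "row_len \<mu> (N + 1 - j') \<le> i'" "i' \<le> row_len \<mu> (N - j')"
      using p q by (auto simp: R_def rim_positions_iff pq)
    have "1 \<le> N - j" "1 \<le> N - j'" using b by linarith+
    then have "row_len \<mu> (N - j) \<le> row_len \<mu> 1" "row_len \<mu> (N - j') \<le> row_len \<mu> 1"
      using row_len_antimono[OF part order_refl] by blast+
    then have "i \<le> row_len \<mu> 1" "i' \<le> row_len \<mu> 1" using b by linarith+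
    \<comment> \<open>The length of the first row separates \<open>i\<close> from \<open>j\<close>,
      so all coordinate sums lie in a window of length \<open>N\<close> and congruent ones are
      equal.\<close>
    then have range: "\<bar>int (i + j) - int (i' + j')\<bar> < int N" using b by linarith
    have "int (i + j + k) mod int N = int (i' + j' + k) mod int N"
      using h unfolding pq zmod_int[symmetric] by simp
    then have "int N dvd int (i + j + k) - int (i' + j' + k)" by (simp only: mod_eq_dvd_iff)
    then have dvd: "int N dvd int (i + j) - int (i' + j')" by (simp add: algebra_simps)
    have "int (i + j) - int (i' + j') = 0"
    proof (rule ccontr)
      assume "int (i + j) - int (i' + j') \<noteq> 0"
      from dvd_imp_le_int[OF this dvd] range show False by linarith
    qed
    then have sum: "i + j = i' + j'" by linarith
    \<comment> \<open>Both coordinates increase weakly along the rim, so two positions with equal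
      sums coincide.\<close>
    have "\<not> j < j'"
    proof
      assume "j < j'"
      then have "1 \<le> N + 1 - j'" "N + 1 - j' \<le> N - j" using b by linarith+
      then show False
        using b sum row_len_antimono[OF part, of "N + 1 - j'" "N - j"] \<open>j < j'\<close> by linarith
    qed
    moreover have "\<not> j' < j"
    proof
      assume "j' < j"
      then have "1 \<le> N + 1 - j" "N + 1 - j \<le> N - j'" using b by linarith+
      then show False
        using b sum row_len_antimono[OF part, of "N + 1 - j" "N - j'"] \<open>j' < j\<close> by linarith
    qed
    ultimately show "p = q" using sum pq by simp
  qed
  have "?h ` R = {..<N}"
  proof (intro equalityI subsetI)
    fix s assume "s \<in> {..<N}"
    then obtain i j where ij: "(i, j) \<in> rim_positions N \<mu>" "?h (i, j) = s"
      using rim_positions_surj[OF \<mu> N, of s] by auto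
    obtain q where "q \<in> R" "site N q = site N (i, j)" using rep[OF ij(1)] by blast
    then show "s \<in> ?h ` R" using h_site[of q "(i, j)"] ij(2) by (intro image_eqI[of _ _ q]) auto
  qed (use N in auto)
  then have "card R = N" using card_image[OF inj] by simp
  moreover have "outer_rim N \<mu> = site N ` R"
    unfolding outer_rim_eq
  proof
    show "site N ` rim_positions N \<mu> \<subseteq> site N ` R"
    proof
      fix x assume "x \<in> site N ` rim_positions N \<mu>"
      then obtain p where "p \<in> rim_positions N \<mu>" "x = site N p" by blast
      then obtain q where "q \<in> R" "x = site N q" using rep by metis
      then show "x \<in> site N ` R" by blast
    qed
    show "site N ` R \<subseteq> site N ` rim_positions N \<mu>" by (auto simp: R_def)
  qed
  moreover have "inj_on (site N) R"
    using inj h_site unfolding inj_on_def by blast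
  ultimately show ?thesis by (simp add: card_image)
qed

section \<open>Partitions whose rim lies in the inner strip\<close>

context odd_cycle_metric
begin

text \<open>The bounds \<open>k - 1 \<le> j - i \<le> k + 2\<close>, arranged so that no subtraction
  of natural numbers can truncate.\<close>

lemma dist_alpha_ge_iff:
  assumes "i \<le> j" "j \<le> N"
  shows "2 * (real k - 1) \<le> d (\<alpha> i) (\<alpha> j) \<longleftrightarrow> i + k \<le> j + 1 \<and> j \<le> i + k + 2"
proof -
  have "d (\<alpha> i) (\<alpha> j) = 2 * min (real j - real i) (2 * real k + 1 - (real j - real i))"
    using dist_alpha[of i j] assms by (simp add: real_N)
  moreover have "i + k \<le> j + 1 \<longleftrightarrow> real i + real k \<le> real j + 1"
    by (metis of_nat_1 of_nat_add of_nat_le_iff)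
  moreover have "j \<le> i + k + 2 \<longleftrightarrow> real j \<le> real i + real k + 2"
    by (metis of_nat_numeral of_nat_add of_nat_le_iff)
  ultimately show ?thesis by (auto simp: min_def)
qed

lemma inner_partitions_iff:
  "\<mu> \<in> inner_partitions k \<alpha> d \<longleftrightarrow> is_partition \<mu> \<and> row_len \<mu> 1 + length \<mu> \<le> N \<and>
    (\<forall>(i, j) \<in> rim_positions N \<mu>. i + k \<le> j + 1 \<and> j \<le> i + k + 2)"
proof -
  have "outer_rim N \<mu> \<subseteq> inner_strip k \<alpha> d \<longleftrightarrow>
      (\<forall>(i, j) \<in> rim_positions N \<mu>. i + k \<le> j + 1 \<and> j \<le> i + k + 2)" if \<mu>: "is_partition \<mu>"
  proof -
    have "site N (i, j) \<in> inner_strip k \<alpha> d \<longleftrightarrow> i + k \<le> j + 1 \<and> j \<le> i + k + 2"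
      if "(i, j) \<in> rim_positions N \<mu>" for i j
    proof -
      note ij = rim_positions_le[OF \<mu> that]
      then have "site N (i, j) \<in> moebius_strip N" by (auto simp: moebius_strip_def)
      moreover have "(\<forall>(i', j') \<in> site N (i, j). 2 * (real k - 1) \<le> d (\<alpha> i') (\<alpha> j')) \<longleftrightarrow>
          2 * (real k - 1) \<le> d (\<alpha> i) (\<alpha> j)"
        by (rule ball_site[of \<alpha> N "\<lambda>x y. 2 * (real k - 1) \<le> d x y", OF alpha_N])
          (simp only: dist_sym)
      ultimately show ?thesis
        unfolding inner_strip_def N_eq[symmetric] mem_Collect_eq dist_alpha_ge_iff[OF ij] by blast
    qed
    then show ?thesis unfolding outer_rim_eq by auto
  qed
  then show ?thesis
    using bounded_hook_partitions_le[of N \<mu>] N_pos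
    unfolding inner_partitions_def N_eq[symmetric] by auto
qed

text \<open>Conversely to the rim of a near-staircase partition staying in the strip, the two rim
  positions at the end of row \<open>r\<close> bound \<open>r + row_len \<mu> r\<close> by
  \<open>k + 2\<close> from above and by \<open>k\<close> from below; the hook bound excludes the
  two end boxes.\<close>

lemma inner_partitions_eq: "inner_partitions k \<alpha> d = near_staircase k"
proof (intro equalityI subsetI)
  fix \<mu> assume \<mu>: "\<mu> \<in> near_staircase k"
  then have part: "is_partition \<mu>" by (simp add: near_staircase_def)
  have "i + k \<le> j + 1 \<and> j \<le> i + k + 2" if "(i, j) \<in> rim_positions N \<mu>" for i j
    using rim_positions_near_staircase[OF \<mu> N_eq that] by auto
  then show "\<mu> \<in> inner_partitions k \<alpha> d"
    unfolding inner_partitions_iff using part near_staircase_lengths[OF \<mu>] N_eq by auto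
next
  fix \<mu> assume "\<mu> \<in> inner_partitions k \<alpha> d"
  then have part: "is_partition \<mu>" and hook: "row_len \<mu> 1 + length \<mu> \<le> N"
    and rim: "(i, j) \<in> rim_positions N \<mu> \<Longrightarrow> i + k \<le> j + 1 \<and> j \<le> i + k + 2" for i j
    by (auto simp: inner_partitions_iff)
  have upper: "r + row_len \<mu> r \<le> k + 2" if "1 \<le> r" "r \<le> length \<mu>" for r
  proof -
    have "(row_len \<mu> r, N - r) \<in> rim_positions N \<mu>"
      using that hook row_len_antimono[OF part, of r "r + 1"] by (auto simp: rim_positions_iff)
    then show ?thesis using rim[of "row_len \<mu> r" "N - r"] that hook N_eq by linarith
  qed
  have first: "row_len \<mu> 1 \<le> k + 1"
    using upper[of 1] by (cases "length \<mu> = 0") (auto simp: row_len_def)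
  have lower: "k \<le> r + row_len \<mu> r" if r: "1 \<le> r" "r \<le> k" for r
  proof -
    have "N + 1 - (N + 1 - r) = r" using r N_eq by simp
    moreover have "row_len \<mu> 1 \<le> N + 1 - r" using first r N_eq by simp
    moreover have "row_len \<mu> r \<le> N - length \<mu>"
      using hook row_len_antimono[OF part, of 1 r] r by simp
    moreover have "row_len \<mu> r \<le> row_len \<mu> (N - (N + 1 - r))" if "r \<noteq> 1"
      using row_len_antimono[OF part, of "r - 1" r] that r N_eq
      by (simp add: Suc_diff_le)
    ultimately have "(row_len \<mu> r, N + 1 - r) \<in> rim_positions N \<mu>"
      using r by (auto simp: rim_positions_iff)
    then show ?thesis using rim[of "row_len \<mu> r" "N + 1 - r"] r N_eq by linarith
  qed
  have "staircase k \<subseteq> young_diagram \<mu>"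
    using lower by (force simp: staircase_def in_young_diagram)
  moreover have "young_diagram \<mu> \<subseteq> staircase (k + 2)"
  proof
    fix b assume "b \<in> young_diagram \<mu>"
    then obtain r c where b: "b = (r, c)" "1 \<le> r" "r \<le> length \<mu>" "1 \<le> c" "c \<le> row_len \<mu> r"
      by (auto simp: young_diagram_def)
    then show "b \<in> staircase (k + 2)" using upper[of r] by (simp add: staircase_def)
  qed
  moreover have "\<not> ((1, k + 1) \<in> young_diagram \<mu> \<and> (k + 1, 1) \<in> young_diagram \<mu>)"
    using hook N_eq unfolding in_first_row in_first_column[OF part] by auto
  ultimately show "\<mu> \<in> near_staircase k" using part by (simp add: near_staircase_def)
qed

section \<open>Transfer of independent sets to the cycle\<close>

lemma beta_image_iff:
  assumes "X \<subseteq> {..<N}"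
  shows "\<beta> s \<in> \<beta> ` X \<longleftrightarrow> s mod N \<in> X"
proof
  assume "\<beta> s \<in> \<beta> ` X"
  then obtain t where "t \<in> X" "s mod N = t mod N" by (auto simp: beta_eq_iff)
  then show "s mod N \<in> X" using assms by auto
next
  assume "s mod N \<in> X"
  moreover have "\<beta> s = \<beta> (s mod N)" by (simp add: beta_eq_iff)
  ultimately show "\<beta> s \<in> \<beta> ` X" by blast
qed

lemma independent_set_image:
  assumes "X \<subseteq> {..<N}"
  shows "independent_set (\<beta> ` X) \<longleftrightarrow> cycle_independent k X"
proof -
  have "independent_set (\<beta> ` X) \<longleftrightarrow> (\<forall>s\<in>X. Suc s mod N \<notin> X)"
    using beta_image_iff[OF assms] by (simp add: independent_set_def)
  moreover have "X \<subseteq> {..2 * k}" using assms by (auto simp: N_eq)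
  ultimately show ?thesis unfolding cycle_independent_def N_eq[symmetric] by simp
qed

lemma independent_set_preimage:
  assumes "independent_set S"
  shows "\<exists>X. cycle_independent k X \<and> S = \<beta> ` X"
proof -
  define X where "X = {s. s < N \<and> \<beta> s \<in> S}"
  have "S = \<beta> ` X" using beta_surj by (force simp: X_def)
  moreover have "X \<subseteq> {..<N}" by (auto simp: X_def)
  ultimately show ?thesis using independent_set_image assms by blast
qed

section \<open>Equations along the rim and edge sums\<close>

lemma extremal_subset: "extremal k \<mu> \<subseteq> {..<N}"
  by (auto simp: extremal_def N_eq)

lemma cycle_independent_range: "cycle_independent k X \<Longrightarrow> X \<subseteq> {..<N}"
  by (auto simp: cycle_independent_def N_eq)

text \<open>Points at maximal distance are joined by an edge, and it starts at
  \<open>\<beta> (i + j + k)\<close>.\<close>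

lemma alpha_pair_near:
  assumes "i \<le> j" "j \<le> N" "j = i + k \<or> j = i + k + 1"
  shows "g $ \<alpha> i + g $ \<alpha> j = d (\<alpha> i) (\<alpha> j) \<longleftrightarrow> edge g $ \<beta> (i + j + k) = 2 * real k"
proof -
  have d: "d (\<alpha> i) (\<alpha> j) = 2 * real k" using assms dist_alpha[of i j] by (auto simp: real_N)
  have ab: "\<alpha> i = \<beta> (2 * i)" "\<alpha> j = \<beta> (2 * j)" using alpha_eq_beta assms by auto
  from assms(3) show ?thesis
  proof
    assume "j = i + k"
    then have e: "i + j + k = 2 * j" "Suc (2 * j) = 2 * i + N" by (auto simp: N_eq)
    show ?thesis unfolding d unfolding ab e(1) edge_beta e(2) beta_add_N by (simp add: add.commute)
  next
    assume "j = i + k + 1"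
    then have e: "i + j + k = 2 * i + N" "2 * j = Suc (2 * i) + N" by (auto simp: N_eq)
    show ?thesis unfolding d unfolding ab e beta_add_N edge_beta by simp
  qed
qed

text \<open>The two points are three steps apart, with middle edge starting at
  \<open>\<beta> (i + j + k)\<close>; their sum is the alternating sum of the three edge
  sums.\<close>

lemma alpha_pair_far:
  assumes "i \<le> j" "j \<le> N" "j + 1 = i + k \<or> j = i + k + 2"
  shows "\<exists>s. \<beta> (Suc s) = \<beta> (i + j + k) \<and>
    (g $ \<alpha> i + g $ \<alpha> j = d (\<alpha> i) (\<alpha> j) \<longleftrightarrow>
     edge g $ \<beta> s + edge g $ \<beta> (Suc (Suc s)) = edge g $ \<beta> (Suc s) + 2 * real k - 2)"
proof -
  have d: "d (\<alpha> i) (\<alpha> j) = 2 * real k - 2" using assms dist_alpha[of i j] by (auto simp: real_N)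
  have ab: "\<alpha> i = \<beta> (2 * i)" "\<alpha> j = \<beta> (2 * j)" using alpha_eq_beta assms by auto
  from assms(3) show ?thesis
  proof
    assume "j + 1 = i + k"
    then have e: "i + j + k = Suc (2 * j)" "Suc (Suc (Suc (2 * j))) = 2 * i + N" by (auto simp: N_eq)
    have "\<beta> (Suc (Suc (Suc (2 * j)))) = \<beta> (2 * i)" unfolding e by (rule beta_add_N)
    then show ?thesis
      unfolding d unfolding ab e(1) by (intro exI[of _ "2 * j"]) (auto simp: edge_beta)
  next
    assume "j = i + k + 2"
    then have e: "i + j + k = Suc (2 * i) + N" "2 * j = Suc (Suc (Suc (2 * i))) + N" by (auto simp: N_eq)
    have "\<beta> (2 * j) = \<beta> (Suc (Suc (Suc (2 * i))))" "\<beta> (i + j + k) = \<beta> (Suc (2 * i))"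
      unfolding e by (rule beta_add_N)+
    then show ?thesis
      unfolding d unfolding ab by (intro exI[of _ "2 * i"]) (auto simp: edge_beta)
  qed
qed

text \<open>Rim sites on non-extremal diagonals fix the edge sums there to \<open>2 * k\<close>. An
  extremal edge has only such neighbours, so the equation of its site then fixes its sum to
  \<open>2 * k + 2\<close>.\<close>

lemma rim_solution_iff:
  assumes \<mu>: "\<mu> \<in> near_staircase k"
  shows "rim_solution k \<alpha> d \<mu> g \<longleftrightarrow> edge g = corner (\<beta> ` extremal k \<mu>)"
proof -
  let ?S = "\<beta> ` extremal k \<mu>"
  have part: "is_partition \<mu>" using \<mu> by (simp add: near_staircase_def)
  have mem: "\<beta> s \<in> ?S \<longleftrightarrow> s mod N \<in> extremal k \<mu>" for s
    by (rule beta_image_iff[OF extremal_subset])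
  have "independent_set ?S"
    using independent_set_image[OF extremal_subset] cycle_independent_extremal[OF \<mu>] by blast
  then have ind: "\<not> (\<beta> s \<in> ?S \<and> \<beta> (Suc s) \<in> ?S)" for s
    unfolding independent_set_def by (metis nxt_beta)
  have rim: "rim_solution k \<alpha> d \<mu> g \<longleftrightarrow>
      (\<forall>(i, j) \<in> rim_positions N \<mu>. g $ \<alpha> i + g $ \<alpha> j = d (\<alpha> i) (\<alpha> j))"
  proof -
    have "(\<forall>(i', j') \<in> site N (i, j). g $ \<alpha> i' + g $ \<alpha> j' = d (\<alpha> i') (\<alpha> j')) \<longleftrightarrow>
        g $ \<alpha> i + g $ \<alpha> j = d (\<alpha> i) (\<alpha> j)" for i j
      by (rule ball_site[of \<alpha> N "\<lambda>x y. g $ x + g $ y = d x y", OF alpha_N])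
        (metis add.commute dist_sym)
    then have "(\<forall>(i', j') \<in> site N p. g $ \<alpha> i' + g $ \<alpha> j' = d (\<alpha> i') (\<alpha> j')) \<longleftrightarrow>
        (case p of (i, j) \<Rightarrow> g $ \<alpha> i + g $ \<alpha> j = d (\<alpha> i) (\<alpha> j))" for p
      by (cases p) (simp only: prod.case)
    then show ?thesis
      unfolding rim_solution_def N_eq[symmetric] outer_rim_eq by simp
  qed
  show ?thesis
  proof
    assume sol: "rim_solution k \<alpha> d \<mu> g"
    have near: "edge g $ \<beta> s = 2 * real k" if "\<beta> s \<notin> ?S" for s
    proof -
      have s: "s mod N \<notin> extremal k \<mu>" using that mem by blast
      obtain i j where ij: "(i, j) \<in> rim_positions N \<mu>" "(i + j + k) mod N = s mod N"
        using rim_positions_surj[OF \<mu> N_eq, of "s mod N"] N_pos by auto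
      have "j = i + k \<or> j = i + k + 1"
        using rim_positions_near_staircase[OF \<mu> N_eq ij(1)] s ij(2) by metis
      moreover have "\<beta> (i + j + k) = \<beta> s" using ij(2) by (simp add: beta_eq_iff)
      moreover have "g $ \<alpha> i + g $ \<alpha> j = d (\<alpha> i) (\<alpha> j)" using sol ij(1) rim by blast
      ultimately show ?thesis
        using alpha_pair_near[of i j g] rim_positions_le[OF part ij(1)] by simp
    qed
    have far: "edge g $ \<beta> s = 2 * real k + 2" if sS: "\<beta> s \<in> ?S" for s
    proof -
      have s: "s mod N \<in> extremal k \<mu>" using that mem by blast
      obtain i j where ij: "(i, j) \<in> rim_positions N \<mu>" "(i + j + k) mod N = s mod N"
        using rim_positions_surj[OF \<mu> N_eq, of "s mod N"] N_pos by auto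
      have "j + 1 = i + k \<or> j = i + k + 2"
        using rim_positions_near_staircase[OF \<mu> N_eq ij(1)] s ij(2) by metis
      moreover have bs: "\<beta> (i + j + k) = \<beta> s" using ij(2) by (simp add: beta_eq_iff)
      moreover have "g $ \<alpha> i + g $ \<alpha> j = d (\<alpha> i) (\<alpha> j)" using sol ij(1) rim by blast
      ultimately obtain t where t: "\<beta> (Suc t) = \<beta> s"
          "edge g $ \<beta> t + edge g $ \<beta> (Suc (Suc t)) = edge g $ \<beta> (Suc t) + 2 * real k - 2"
        using alpha_pair_far[of i j g] rim_positions_le[OF part ij(1)] by auto
      have "\<beta> t \<notin> ?S" "\<beta> (Suc (Suc t)) \<notin> ?S"
        using ind[of t] ind[of "Suc t"] sS t(1) by auto
      then show ?thesis using t near[of t] near[of "Suc (Suc t)"] by simp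
    qed
    show "edge g = corner ?S"
      unfolding vec_eq_iff all_beta corner_nth using near far by simp
  next
    assume e: "edge g = corner ?S"
    have "g $ \<alpha> i + g $ \<alpha> j = d (\<alpha> i) (\<alpha> j)" if ij: "(i, j) \<in> rim_positions N \<mu>" for i j
    proof -
      note le = rim_positions_le[OF part ij]
      from rim_positions_near_staircase[OF \<mu> N_eq ij] show ?thesis
      proof
        assume a: "(j = i + k \<or> j = i + k + 1) \<and> (i + j + k) mod N \<notin> extremal k \<mu>"
        then show ?thesis
          using alpha_pair_near[OF le, of g] mem[of "i + j + k"] by (simp add: e corner_nth)
      next
        assume a: "(j + 1 = i + k \<or> j = i + k + 2) \<and> (i + j + k) mod N \<in> extremal k \<mu>"
        then obtain s where s: "\<beta> (Suc s) = \<beta> (i + j + k)"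
            "g $ \<alpha> i + g $ \<alpha> j = d (\<alpha> i) (\<alpha> j) \<longleftrightarrow>
             edge g $ \<beta> s + edge g $ \<beta> (Suc (Suc s)) = edge g $ \<beta> (Suc s) + 2 * real k - 2"
          using alpha_pair_far[OF le, of g] by blast
        have "\<beta> (Suc s) \<in> ?S" using s(1) mem a by simp
        then have "\<beta> s \<notin> ?S" "\<beta> (Suc (Suc s)) \<notin> ?S" using ind[of s] ind[of "Suc s"] by auto
        then show ?thesis using \<open>\<beta> (Suc s) \<in> ?S\<close> unfolding s(2) e corner_nth by simp
      qed
    qed
    then show "rim_solution k \<alpha> d \<mu> g" using rim by blast
  qed
qed

lemma rim_solution_unique:
  "\<mu> \<in> near_staircase k \<Longrightarrow> rim_solution k \<alpha> d \<mu> g \<longleftrightarrow> g = hull_vertex (\<beta> ` extremal k \<mu>)"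
  by (simp add: rim_solution_iff hull_vertex_unique)

lemma rim_vertex_eq:
  "\<mu> \<in> near_staircase k \<Longrightarrow> rim_vertex k \<alpha> d \<mu> = hull_vertex (\<beta> ` extremal k \<mu>)"
  by (simp add: rim_vertex_def rim_solution_unique)

section \<open>Coordinates of the vertices\<close>

lemma hull_vertex_nth:
  assumes "X \<subseteq> {..<N}"
  shows "hull_vertex (\<beta> ` X) $ \<beta> s =
    real k + (\<Sum>l<N. (- 1) ^ l * of_bool ((s + l) mod N \<in> X))"
proof -
  have one: "(\<Sum>l<N. (- 1) ^ l) = (1 :: real)"
    unfolding N_eq by (induction k) auto
  have "2 * hull_vertex (\<beta> ` X) $ \<beta> s =
      (\<Sum>l<N. (- 1) ^ l * (2 * real k + 2 * of_bool ((s + l) mod N \<in> X)))"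
    unfolding edge_alternating_sum edge_hull_vertex corner_nth beta_image_iff[OF assms] ..
  also have "\<dots> = 2 * real k * (\<Sum>l<N. (- 1) ^ l) +
      2 * (\<Sum>l<N. (- 1) ^ l * of_bool ((s + l) mod N \<in> X))"
    by (simp only: sum_distrib_left sum.distrib[symmetric]) (simp add: algebra_simps)
  finally show ?thesis unfolding one by simp
qed

lemma hull_vertex_nth_0:
  assumes \<mu>: "\<mu> \<in> near_staircase k"
  shows "hull_vertex (\<beta> ` extremal k \<mu>) $ \<beta> 0 = real (sum_list \<mu>) - real k * (real k - 1) / 2"
  unfolding hull_vertex_nth[OF extremal_subset] sum_list_near_staircase[OF \<mu>] N_eq[symmetric]
  by simp

lemma hull_vertex_shift:
  assumes \<mu>: "\<mu> \<in> near_staircase k"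
  shows "hull_vertex (\<beta> ` extremal k (cyclic_shift N \<mu>)) $ \<beta> s =
    hull_vertex (\<beta> ` extremal k \<mu>) $ \<beta> (s + 2)"
proof -
  have "(s + l) mod N \<in> extremal k (cyclic_shift N \<mu>) \<longleftrightarrow> (s + 2 + l) mod N \<in> extremal k \<mu>" for l
  proof -
    have "(s + l) mod N \<le> 2 * k" using N_pos mod_less_divisor[of N "s + l"] by (simp add: N_eq)
    from cyclic_shift_near_staircase(2)[OF \<mu> this, folded N_eq]
    have "(s + l) mod N \<in> extremal k (cyclic_shift N \<mu>) \<longleftrightarrow> (s + l + 2) mod N \<in> extremal k \<mu>"
      by (simp only: mod_add_left_eq)
    then show ?thesis by (simp add: add.commute add.left_commute)
  qed
  then show ?thesis unfolding hull_vertex_nth[OF extremal_subset] by simp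
qed

text \<open>Each shift advances the argument by two along \<open>\<beta>\<close>, and
  \<open>\<alpha> j = \<beta> (2 * j)\<close>; so after \<open>j\<close> shifts the coordinate is
  read off at \<open>\<beta> 0\<close>, where it is a size.\<close>

lemma rim_vertex_nth:
  assumes \<mu>: "\<mu> \<in> near_staircase k" and "j \<le> N"
  shows "rim_vertex k \<alpha> d \<mu> $ \<alpha> j =
    real (sum_list ((cyclic_shift N ^^ j) \<mu>)) - real k * (real k - 1) / 2"
proof -
  have "(cyclic_shift N ^^ j) \<mu> \<in> near_staircase k \<and>
      (\<forall>s. hull_vertex (\<beta> ` extremal k ((cyclic_shift N ^^ j) \<mu>)) $ \<beta> s =
        hull_vertex (\<beta> ` extremal k \<mu>) $ \<beta> (s + 2 * j))"
  proof (induction j)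
    case (Suc j)
    then show ?case
      using cyclic_shift_near_staircase(1)[of "(cyclic_shift N ^^ j) \<mu>" k, folded N_eq]
        hull_vertex_shift[of "(cyclic_shift N ^^ j) \<mu>"] by (simp add: algebra_simps)
  qed (simp add: \<mu>)
  then show ?thesis
    using hull_vertex_nth_0[of "(cyclic_shift N ^^ j) \<mu>"] alpha_eq_beta[OF \<open>j \<le> N\<close>]
    by (simp add: rim_vertex_eq[OF \<mu>])
qed

section \<open>Vertices and faces parametrized by partitions\<close>

lemma inj_image_beta:
  assumes "X \<subseteq> {..<N}" "Y \<subseteq> {..<N}"
  shows "\<beta> ` X = \<beta> ` Y \<longleftrightarrow> X = Y" "\<beta> ` X \<subseteq> \<beta> ` Y \<longleftrightarrow> X \<subseteq> Y"
  using beta_bij assms unfolding bij_betw_def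
  by (auto simp: inj_on_image_eq_iff inj_on_image_subset_iff)

lemma bij_rim_vertex: "bij_betw (rim_vertex k \<alpha> d) (near_staircase k) (hull_vertices d)"
proof (rule bij_betw_imageI)
  show "inj_on (rim_vertex k \<alpha> d) (near_staircase k)"
    using inj_on_extremal
    by (auto simp: inj_on_def rim_vertex_eq inj_hull_vertex inj_image_beta(1)[OF extremal_subset extremal_subset])
  have "{S. independent_set S} = (\<lambda>X. \<beta> ` X) ` {X. cycle_independent k X}"
    using independent_set_preimage independent_set_image[OF cycle_independent_range] by blast
  also have "{X. cycle_independent k X} = extremal k ` near_staircase k"
    using bij_betw_extremal by (simp add: bij_betw_def)
  finally show "rim_vertex k \<alpha> d ` near_staircase k = hull_vertices d"
    unfolding hull_vertices_eq by (simp add: image_image rim_vertex_eq cong: image_cong)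
qed

lemma rim_vertex_interval:
  assumes \<mu>: "\<mu> \<in> near_staircase k" and \<mu>': "\<mu>' \<in> near_staircase k"
    and rem: "removes_corners v \<mu> \<mu>'"
  defines "S \<equiv> extremal k \<mu> \<union> extremal k \<mu>'" and "S' \<equiv> extremal k \<mu> \<inter> extremal k \<mu>'"
  shows "rim_vertex k \<alpha> d ` young_interval \<mu>' \<mu> =
    hull_vertex ` {T. \<beta> ` S' \<subseteq> T \<and> T \<subseteq> \<beta> ` S}"
proof -
  note R = removes_corners_extremal[OF \<mu> \<mu>' rem]
  have SN: "S \<subseteq> {..<N}" "S' \<subseteq> {..<N}" using extremal_subset by (auto simp: S_def S'_def)
  have "rim_vertex k \<alpha> d ` young_interval \<mu>' \<mu> =
      (\<lambda>X. hull_vertex (\<beta> ` X)) ` extremal k ` young_interval \<mu>' \<mu>"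
    unfolding image_image
    by (rule image_cong) (use near_staircase_interval[OF \<mu> \<mu>'] rim_vertex_eq in blast)+
  also have "extremal k ` young_interval \<mu>' \<mu> = {X. S' \<subseteq> X \<and> X \<subseteq> S}"
    unfolding S_def S'_def by (rule extremal_interval[OF \<mu> \<mu>' R(1,2)])
  also have "(\<lambda>X. hull_vertex (\<beta> ` X)) ` {X. S' \<subseteq> X \<and> X \<subseteq> S} =
      hull_vertex ` (\<lambda>X. \<beta> ` X) ` {X. S' \<subseteq> X \<and> X \<subseteq> S}"
    by (simp add: image_image)
  also have "(\<lambda>X. \<beta> ` X) ` {X. S' \<subseteq> X \<and> X \<subseteq> S} = {T. \<beta> ` S' \<subseteq> T \<and> T \<subseteq> \<beta> ` S}"
  proof (intro equalityI subsetI)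
    fix T assume "T \<in> {T. \<beta> ` S' \<subseteq> T \<and> T \<subseteq> \<beta> ` S}"
    then obtain X where X: "X \<subseteq> S" "T = \<beta> ` X" "\<beta> ` S' \<subseteq> \<beta> ` X"
      by (auto simp: subset_image_iff)
    then have "S' \<subseteq> X" using inj_image_beta(2)[of S' X] SN by blast
    then show "T \<in> (\<lambda>X. \<beta> ` X) ` {X. S' \<subseteq> X \<and> X \<subseteq> S}" using X by blast
  qed auto
  finally show ?thesis .
qed

lemma card_rim_vertex_interval:
  assumes \<mu>: "\<mu> \<in> near_staircase k" and \<mu>': "\<mu>' \<in> near_staircase k"
    and rem: "removes_corners v \<mu> \<mu>'"
  shows "card (rim_vertex k \<alpha> d ` young_interval \<mu>' \<mu>) = 2 ^ v"
proof -
  note R = removes_corners_extremal[OF \<mu> \<mu>' rem]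
  let ?S = "extremal k \<mu> \<union> extremal k \<mu>'" and ?S' = "extremal k \<mu> \<inter> extremal k \<mu>'"
  have int: "young_interval \<mu>' \<mu> \<subseteq> near_staircase k" by (rule near_staircase_interval[OF \<mu> \<mu>'])
  have "card (rim_vertex k \<alpha> d ` young_interval \<mu>' \<mu>) = card (young_interval \<mu>' \<mu>)"
    by (rule card_image) (rule inj_on_subset[OF bij_betw_imp_inj_on[OF bij_rim_vertex] int])
  also have "\<dots> = card (extremal k ` young_interval \<mu>' \<mu>)"
    by (rule card_image[symmetric]) (rule inj_on_subset[OF inj_on_extremal int])
  also have "\<dots> = card {X. ?S' \<subseteq> X \<and> X \<subseteq> ?S}"
    by (simp only: extremal_interval[OF \<mu> \<mu>' R(1,2)])
  also have "{X. ?S' \<subseteq> X \<and> X \<subseteq> ?S} = (\<union>) ?S' ` Pow (?S - ?S')"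
  proof (intro equalityI subsetI)
    fix X assume "X \<in> {X. ?S' \<subseteq> X \<and> X \<subseteq> ?S}"
    then show "X \<in> (\<union>) ?S' ` Pow (?S - ?S')" by (intro image_eqI[of _ _ "X - ?S'"]) auto
  qed auto
  also have "card \<dots> = card (Pow (?S - ?S'))"
    by (rule card_image) (auto simp: inj_on_def)
  also have "\<dots> = 2 ^ v"
    using R(3) finite_subset[OF extremal_subset] by (simp add: card_Pow)
  finally show ?thesis .
qed

lemma hull_faces_eq:
  "{F. hull_face d v F} =
    {convex hull (rim_vertex k \<alpha> d ` young_interval \<mu>' \<mu>) | \<mu> \<mu>'.
      \<mu> \<in> near_staircase k \<and> \<mu>' \<in> near_staircase k \<and> removes_corners v \<mu> \<mu>'}"
proof (intro equalityI subsetI)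
  fix F assume "F \<in> {F. hull_face d v F}"
  then obtain S S' where S: "independent_set S" "S' \<subseteq> S" "card (S - S') = v"
      "F = convex hull (hull_vertex ` {T. S' \<subseteq> T \<and> T \<subseteq> S})"
    unfolding hull_face_iff by blast
  obtain X where X: "cycle_independent k X" "S = \<beta> ` X" using independent_set_preimage[OF S(1)] by blast
  then obtain X' where X': "X' \<subseteq> X" "S' = \<beta> ` X'" using S(2) by (auto simp: subset_image_iff)
  have inj: "inj_on \<beta> X"
    using inj_on_subset[OF bij_betw_imp_inj_on[OF beta_bij] cycle_independent_range[OF X(1)]] .
  have "S - S' = \<beta> ` (X - X')" using inj_on_image_set_diff[OF inj, of X X'] X X' by auto
  then have card: "card (X - X') = v" using S(3) card_image[OF inj_on_subset[OF inj, of "X - X'"]] by auto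
  obtain \<mu> \<mu>' where \<mu>: "\<mu> \<in> near_staircase k" "\<mu>' \<in> near_staircase k" "removes_corners v \<mu> \<mu>'"
      "extremal k \<mu> \<union> extremal k \<mu>' = X" "extremal k \<mu> \<inter> extremal k \<mu>' = X'"
    using removes_corners_surj[OF X(1) X'(1)] card by auto
  have "F = convex hull (rim_vertex k \<alpha> d ` young_interval \<mu>' \<mu>)"
    unfolding S(4) rim_vertex_interval[OF \<mu>(1-3)] \<mu>(4,5) X(2) X'(2) ..
  then show "F \<in> {convex hull (rim_vertex k \<alpha> d ` young_interval \<mu>' \<mu>) | \<mu> \<mu>'.
      \<mu> \<in> near_staircase k \<and> \<mu>' \<in> near_staircase k \<and> removes_corners v \<mu> \<mu>'}"
    using \<mu> by blast
next
  fix F assume "F \<in> {convex hull (rim_vertex k \<alpha> d ` young_interval \<mu>' \<mu>) | \<mu> \<mu>'.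
      \<mu> \<in> near_staircase k \<and> \<mu>' \<in> near_staircase k \<and> removes_corners v \<mu> \<mu>'}"
  then obtain \<mu> \<mu>' where \<mu>: "\<mu> \<in> near_staircase k" "\<mu>' \<in> near_staircase k" "removes_corners v \<mu> \<mu>'"
      and F: "F = convex hull (rim_vertex k \<alpha> d ` young_interval \<mu>' \<mu>)" by blast
  let ?S = "extremal k \<mu> \<union> extremal k \<mu>'" and ?S' = "extremal k \<mu> \<inter> extremal k \<mu>'"
  note R = removes_corners_extremal[OF \<mu>]
  have inj: "inj_on \<beta> ?S"
    using inj_on_subset[OF bij_betw_imp_inj_on[OF beta_bij] cycle_independent_range[OF R(2)]] .
  have "\<beta> ` ?S - \<beta> ` ?S' = \<beta> ` (?S - ?S')" using inj_on_image_set_diff[OF inj, of ?S ?S'] by auto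
  then have "card (\<beta> ` ?S - \<beta> ` ?S') = v"
    using R(3) card_image[OF inj_on_subset[OF inj, of "?S - ?S'"]] by auto
  moreover have "independent_set (\<beta> ` ?S)"
    using independent_set_image[OF cycle_independent_range[OF R(2)]] R(2) by blast
  moreover have "\<beta> ` ?S' \<subseteq> \<beta> ` ?S" by blast
  ultimately show "F \<in> {F. hull_face d v F}"
    unfolding mem_Collect_eq hull_face_iff F rim_vertex_interval[OF \<mu>] by blast
qed

end

theorem theorem4p2:
  fixes k N :: nat and \<alpha> :: "nat \<Rightarrow> 'n::finite" and d :: "'n \<Rightarrow> 'n \<Rightarrow> real"
  assumes "N = 2 * k + 1" and "odd_cycle k \<alpha> d"
  shows
    "(\<forall>\<mu> \<in> inner_partitions k \<alpha> d.
        card (outer_rim N \<mu>) = N \<and>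
        (\<exists>!g. rim_solution k \<alpha> d \<mu> g) \<and>
        (\<forall>j<N. rim_vertex k \<alpha> d \<mu> $ \<alpha> j =
           real (sum_list ((cyclic_shift N ^^ j) \<mu>)) - real k * (real k - 1) / 2)) \<and>
     bij_betw (rim_vertex k \<alpha> d) (inner_partitions k \<alpha> d) (hull_vertices d) \<and>
     (\<forall>v.
        (\<forall>\<mu> \<in> inner_partitions k \<alpha> d. \<forall>\<mu>' \<in> inner_partitions k \<alpha> d.
           removes_corners v \<mu> \<mu>' \<longrightarrow>
           young_interval \<mu>' \<mu> \<subseteq> inner_partitions k \<alpha> d \<and>
           card (rim_vertex k \<alpha> d ` young_interval \<mu>' \<mu>) = 2 ^ v) \<and>
        {F. hull_face d v F} =
          {convex hull (rim_vertex k \<alpha> d ` young_interval \<mu>' \<mu>) | \<mu> \<mu>'.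
             \<mu> \<in> inner_partitions k \<alpha> d \<and> \<mu>' \<in> inner_partitions k \<alpha> d \<and>
             removes_corners v \<mu> \<mu>'})"
proof -
  interpret odd_cycle_metric k N \<alpha> d
    using assms by unfold_locales
  have "\<exists>!g. rim_solution k \<alpha> d \<mu> g" if "\<mu> \<in> near_staircase k" for \<mu>
    using rim_solution_unique[OF that] by simp
  then show ?thesis
    unfolding inner_partitions_eq
    using card_outer_rim[OF _ N_eq] rim_vertex_nth bij_rim_vertex near_staircase_interval
      card_rim_vertex_interval hull_faces_eq
    by (intro conjI ballI allI impI) simp_all
qed

end
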